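(* Let $(X,\mu,H,\Pi,\mathcal{M}_0,A)$ be as in the Abstract Setting and suppose there is $x_0\in X$ such that (i') $x_0$ is a peak point for $A$: there is $f_0\in A$ with $f_0(x_0)=1$ and $|f_0(x)|<1$ for all $x\in X\setminus\{x_0\}$; and (ii') $\sigma(\{x_0\})=0$ for every $\sigma\in\mathcal{M}_0$. Then $\Pi$ cannot be extended to a bounded linear operator on $L^1(X,\mu)$.
   Context: Abstract Setting: $X$ is a compact connected Hausdorff space; $\mu$ is a finite regular Borel measure of full support. $\mathcal{M}(X)$ is the space of regular complex Borel measures on $X$ (dual of $C(X)$) with weak-$*$ topology, $L^1(X,\mu)\subset\mathcal{M}(X)$ via $f\mapsto f\,d\mu$. $H$ is a closed subspace of $L^2(X,\mu)$, $\Pi$ the orthogonal projection onto $H$, $\mathcal{M}_0$ the weak-$*$ closure of $H$ in $\mathcal{M}(X)$, and $A\subseteq C(X)\cap H$ a linear subspace containing constants and closed under multiplication. "$\Pi$ extends boundedly to $L^1$" means $\|\Pi f\|_{L^1}\le C\|f\|_{L^1}$ for all $f\in L^2(X,\mu)$ and some $C<\infty$. *)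

theory Defs
  imports "HOL-Analysis.Analysis"
begin

definition finite_regular_borel :: "'a::topological_space measure \<Rightarrow> bool" where
  "finite_regular_borel \<nu> \<longleftrightarrow>
     sets \<nu> = sets borel \<and> finite_measure \<nu> \<and>
     (\<forall>E\<in>sets borel.
        emeasure \<nu> E = (INF U\<in>{U. open U \<and> E \<subseteq> U}. emeasure \<nu> U) \<and>
        emeasure \<nu> E = (SUP K\<in>{K. compact K \<and> K \<subseteq> E}. emeasure \<nu> K))"

definition full_support :: "'a::topological_space measure \<Rightarrow> bool" where
  "full_support \<mu> \<longleftrightarrow> (\<forall>U. open U \<and> U \<noteq> {} \<longrightarrow> emeasure \<mu> U > 0)"

definition square_integrable :: "'a measure \<Rightarrow> ('a \<Rightarrow> complex) \<Rightarrow> bool" where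
  "square_integrable \<mu> f \<longleftrightarrow>
     f \<in> borel_measurable \<mu> \<and> integrable \<mu> (\<lambda>x. (cmod (f x))\<^sup>2)"

text \<open>H is a closed linear subspace of L^2(mu), given as a set of representatives
  which is closed under a.e. equality.\<close>
definition closed_L2_subspace :: "'a measure \<Rightarrow> ('a \<Rightarrow> complex) set \<Rightarrow> bool" where
  "closed_L2_subspace \<mu> H \<longleftrightarrow>
     (\<forall>h\<in>H. square_integrable \<mu> h) \<and>
     (\<lambda>x. 0) \<in> H \<and>
     (\<forall>f\<in>H. \<forall>g\<in>H. (\<lambda>x. f x + g x) \<in> H) \<and>
     (\<forall>c. \<forall>f\<in>H. (\<lambda>x. c * f x) \<in> H) \<and>
     (\<forall>f\<in>H. \<forall>g. g \<in> borel_measurable \<mu> \<and> (AE x in \<mu>. f x = g x) \<longrightarrow> g \<in> H) \<and>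
     (\<forall>h f. (\<forall>n. h n \<in> H) \<and> square_integrable \<mu> f \<and>
        (\<lambda>n. integral\<^sup>L \<mu> (\<lambda>x. (cmod (h n x - f x))\<^sup>2)) \<longlonglongrightarrow> 0 \<longrightarrow> f \<in> H)"

definition orth_proj_L2 ::
  "'a measure \<Rightarrow> ('a \<Rightarrow> complex) set \<Rightarrow> ('a \<Rightarrow> complex) \<Rightarrow> ('a \<Rightarrow> complex) \<Rightarrow> bool" where
  "orth_proj_L2 \<mu> H f g \<longleftrightarrow>
     g \<in> H \<and> (\<forall>h\<in>H. integral\<^sup>L \<mu> (\<lambda>x. (f x - g x) * cnj (h x)) = 0)"

definition proj_extends_boundedly_L1 :: "'a measure \<Rightarrow> ('a \<Rightarrow> complex) set \<Rightarrow> bool" where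
  "proj_extends_boundedly_L1 \<mu> H \<longleftrightarrow>
     (\<exists>C::real. \<forall>f g. square_integrable \<mu> f \<and> orth_proj_L2 \<mu> H f g \<longrightarrow>
        integral\<^sup>L \<mu> (\<lambda>x. cmod (g x)) \<le> C * integral\<^sup>L \<mu> (\<lambda>x. cmod (f x)))"

text \<open>A regular complex Borel measure is represented as u d\<nu> with \<nu> a finite regular
  Borel measure and u \<in> L^1(\<nu>) (every regular complex measure has this form, e.g.
  with \<nu> = |\<sigma>|).  The predicate says that the measure u d\<nu> lies in the weak-* closure
  of H (embedded via h \<mapsto> h d\<mu>) in M(X) = C(X)^*, via the basic weak-* neighbourhoods.\<close>
definition in_weak_star_closure ::
  "'a::topological_space measure \<Rightarrow> ('a \<Rightarrow> complex) set \<Rightarrow> 'a measure \<Rightarrow> ('a \<Rightarrow> complex) \<Rightarrow> bool" where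
  "in_weak_star_closure \<mu> H \<nu> u \<longleftrightarrow>
     (\<forall>G \<epsilon>. finite G \<and> (\<forall>g\<in>G. continuous_on UNIV g) \<and> \<epsilon> > 0 \<longrightarrow>
        (\<exists>h\<in>H. \<forall>g\<in>G.
           cmod (integral\<^sup>L \<nu> (\<lambda>x. g x * u x) - integral\<^sup>L \<mu> (\<lambda>x. g x * h x)) < \<epsilon>))"

end

theory Submission
  imports Defs
begin

text \<open>
  Suppose the projection is bounded on \<open>L\<^sup>1\<close>. Normalised indicators \<open>f n\<close> of the neighbourhoods
  \<open>{|f0 - 1| < 1/(n+1)}\<close> have projections \<open>g n \<in> H\<close> that are bounded in \<open>L\<^sup>1\<close>, so by weak-* compactness
  they cluster at a regular measure \<open>\<sigma> = u d\<nu>\<close> in the weak-* closure of \<open>H\<close>. Since the powers of \<open>f0\<close>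
  lie in \<open>H\<close>, orthogonality gives \<open>\<integral> cnj (f0 ^ k) d\<sigma> = lim \<integral> cnj (f0 ^ k) f n d\<mu> = 1\<close> for every \<open>k\<close>, and
  letting \<open>k\<close> tend to infinity yields \<open>\<sigma> {x0} = 1\<close>.

  The cluster measure is obtained by applying Tychonoff's theorem and the Riesz representation theorem
  to the positive and negative parts of \<open>Re (g n)\<close> and \<open>Im (g n)\<close>; the four limit measures are
  recombined through their Radon-Nikodym densities with respect to the measure of the sum functional.
\<close>

section \<open>Orthogonal projection in the space of square-integrable functions\<close>

lemma square_integrable_mult:
  assumes "square_integrable M f" "square_integrable M g"
  shows "integrable M (\<lambda>x. f x * cnj (g x))"
proof (rule Bochner_Integration.integrable_bound)
  have [measurable]: "f \<in> borel_measurable M" "g \<in> borel_measurable M"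
    using assms by (auto simp: square_integrable_def)
  show "integrable M (\<lambda>x. (cmod (f x))\<^sup>2 + (cmod (g x))\<^sup>2)"
    using assms by (auto simp: square_integrable_def)
  show "(\<lambda>x. f x * cnj (g x)) \<in> borel_measurable M"
    by (intro borel_measurable_times borel_measurable_continuous_on[of cnj] continuous_intros) measurable
  have "cmod (f x) * cmod (g x) \<le> (cmod (f x))\<^sup>2 + (cmod (g x))\<^sup>2" for x
    using sum_squares_bound[of "cmod (f x)" "cmod (g x)"]
      mult_nonneg_nonneg[OF norm_ge_zero[of "f x"] norm_ge_zero[of "g x"]] by linarith
  then show "AE x in M. norm (f x * cnj (g x)) \<le> norm ((cmod (f x))\<^sup>2 + (cmod (g x))\<^sup>2)"
    by (auto simp: norm_mult)
qed

lemma square_integrable_scale: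
  "square_integrable M f \<Longrightarrow> square_integrable M (\<lambda>x. c * f x)"
  by (auto simp: square_integrable_def norm_mult power_mult_distrib)

lemma cmod_add_squared: "(cmod (a + b))\<^sup>2 = (cmod a)\<^sup>2 + 2 * Re (a * cnj b) + (cmod b)\<^sup>2"
  unfolding cmod_power2 by (simp add: power2_eq_square algebra_simps)

lemma square_integrable_add:
  assumes "square_integrable M f" "square_integrable M g"
  shows "square_integrable M (\<lambda>x. f x + g x)"
  unfolding square_integrable_def cmod_add_squared
  using assms integrable_Re[OF square_integrable_mult[OF assms]]
  by (auto simp: square_integrable_def simp del: times_complex.sel)

lemma square_integrable_diff:
  assumes "square_integrable M f" "square_integrable M g"
  shows "square_integrable M (\<lambda>x. f x - g x)"
  using square_integrable_add[OF assms(1) square_integrable_scale[OF assms(2), of "-1"]] by simp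

text \<open>Fatou's lemma for squared moduli. The threshold \<open>N\<close> admits bounds that hold
  only for late indices, as a Cauchy estimate provides.\<close>

lemma integral_cmod_squared_liminf_bound:
  fixes h :: "nat \<Rightarrow> 'a \<Rightarrow> complex"
  assumes h: "\<And>n. square_integrable M (h n)" and g: "g \<in> borel_measurable M"
    and lim: "AE x in M. (\<lambda>n. h n x) \<longlonglongrightarrow> g x"
    and b: "b \<longlonglongrightarrow> B" "\<And>n. n \<ge> N \<Longrightarrow> (\<integral>x. (cmod (h n x))\<^sup>2 \<partial>M) \<le> b n"
  shows "square_integrable M g" "(\<integral>x. (cmod (g x))\<^sup>2 \<partial>M) \<le> B"
proof -
  have [measurable]: "h n \<in> borel_measurable M" "g \<in> borel_measurable M" for n
    using h g by (auto simp: square_integrable_def)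
  have "(\<integral>\<^sup>+x. ennreal ((cmod (g x))\<^sup>2) \<partial>M) = (\<integral>\<^sup>+x. liminf (\<lambda>n. ennreal ((cmod (h n x))\<^sup>2)) \<partial>M)"
  proof (rule nn_integral_cong_AE, use lim in eventually_elim)
    fix x assume "(\<lambda>n. h n x) \<longlonglongrightarrow> g x"
    then have "(\<lambda>n. ennreal ((cmod (h n x))\<^sup>2)) \<longlonglongrightarrow> ennreal ((cmod (g x))\<^sup>2)"
      by (intro tendsto_intros)
    then show "ennreal ((cmod (g x))\<^sup>2) = liminf (\<lambda>n. ennreal ((cmod (h n x))\<^sup>2))"
      using lim_imp_Liminf[OF sequentially_bot] by metis
  qed
  also have "\<dots> \<le> liminf (\<lambda>n. \<integral>\<^sup>+x. ennreal ((cmod (h n x))\<^sup>2) \<partial>M)"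
    by (rule nn_integral_liminf) measurable
  also have "\<dots> = liminf (\<lambda>n. ennreal (\<integral>x. (cmod (h n x))\<^sup>2 \<partial>M))"
    using h by (subst nn_integral_eq_integral) (auto simp: square_integrable_def)
  also have "\<dots> \<le> liminf (\<lambda>n. ennreal (b n))"
    using b(2) by (intro Liminf_mono eventually_sequentiallyI[of N] ennreal_leI)
  also have "\<dots> = ennreal B"
    using b(1) by (intro lim_imp_Liminf sequentially_bot tendsto_ennrealI)
  finally have *: "(\<integral>\<^sup>+x. ennreal ((cmod (g x))\<^sup>2) \<partial>M) \<le> ennreal B" .
  have "integrable M (\<lambda>x. (cmod (g x))\<^sup>2)"
    by (rule integrableI_nonneg) (use * in \<open>auto intro: le_less_trans\<close>)
  then show "square_integrable M g"
    by (simp add: square_integrable_def)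
  \<comment> \<open>\<open>ennreal\<close> sends negative reals to 0, so the bound returns to the
    reals only once \<open>B\<close> is known to be nonnegative.\<close>
  have "0 \<le> B"
    using b by (intro LIMSEQ_le_const[OF b(1)])
      (meson Bochner_Integration.integral_nonneg order_trans zero_le_power2)
  then show "(\<integral>x. (cmod (g x))\<^sup>2 \<partial>M) \<le> B"
    using * \<open>integrable M (\<lambda>x. (cmod (g x))\<^sup>2)\<close>
    by (simp add: nn_integral_eq_integral)
qed

text \<open>Even with the weights \<open>2 ^ n\<close>, the squared differences have summable
  integrals, so their weighted sum is finite almost everywhere. The weights are then spent on
  passing from squares to absolute values.\<close>

lemma AE_convergent_of_fast_L2_Cauchy:
  fixes h :: "nat \<Rightarrow> 'a \<Rightarrow> complex"
  assumes h: "\<And>n. square_integrable M (h n)"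
    and fast: "\<And>n. (\<integral>x. (cmod (h (Suc n) x - h n x))\<^sup>2 \<partial>M) \<le> c * (1/4) ^ n"
  shows "AE x in M. convergent (\<lambda>n. h n x)"
proof -
  have [measurable]: "h n \<in> borel_measurable M" for n
    using h by (auto simp: square_integrable_def)
  have int: "integrable M (\<lambda>x. (cmod (h (Suc n) x - h n x))\<^sup>2)" for n
    using square_integrable_diff[OF h h] by (auto simp: square_integrable_def)
  have "(\<integral>\<^sup>+x. (\<Sum>n. ennreal (2 ^ n * (cmod (h (Suc n) x - h n x))\<^sup>2)) \<partial>M)
      = (\<Sum>n. \<integral>\<^sup>+x. ennreal (2 ^ n * (cmod (h (Suc n) x - h n x))\<^sup>2) \<partial>M)"
    by (rule nn_integral_suminf) measurable
  also have "\<dots> = (\<Sum>n. ennreal (2 ^ n * (\<integral>x. (cmod (h (Suc n) x - h n x))\<^sup>2 \<partial>M)))"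
    using int by (subst nn_integral_eq_integral) auto
  also have "\<dots> \<le> (\<Sum>n. ennreal (c * (1/2) ^ n))"
  proof (intro suminf_le ennreal_leI allI)
    fix n
    have "2 ^ n * (\<integral>x. (cmod (h (Suc n) x - h n x))\<^sup>2 \<partial>M) \<le> 2 ^ n * (c * (1/4) ^ n)"
      using fast by (intro mult_left_mono) auto
    also have "\<dots> = c * (2 * (1/4)) ^ n"
      by (simp only: power_mult_distrib) simp
    finally show "2 ^ n * (\<integral>x. (cmod (h (Suc n) x - h n x))\<^sup>2 \<partial>M) \<le> c * (1/2) ^ n"
      by simp
  qed auto
  also have "\<dots> < \<infinity>"
  proof -
    have "0 \<le> c"
      using fast[of 0] by (simp, meson Bochner_Integration.integral_nonneg order_trans zero_le_power2)
    moreover have "summable (\<lambda>n. c * (1/2::real) ^ n)"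
      by (intro summable_mult summable_geometric) simp
    ultimately show ?thesis
      by (subst suminf_ennreal2) auto
  qed
  finally have "AE x in M. (\<Sum>n. ennreal (2 ^ n * (cmod (h (Suc n) x - h n x))\<^sup>2)) \<noteq> \<infinity>"
    by (intro nn_integral_PInf_AE) auto
  then show ?thesis
  proof eventually_elim
    fix x assume x: "(\<Sum>n. ennreal (2 ^ n * (cmod (h (Suc n) x - h n x))\<^sup>2)) \<noteq> \<infinity>"
    then have s: "summable (\<lambda>n. 2 ^ n * (cmod (h (Suc n) x - h n x))\<^sup>2)"
      by (intro summable_suminf_not_top) auto
    have "summable (\<lambda>n. h (Suc n) x - h n x)"
    proof (rule summable_comparison_test')
      show "summable (\<lambda>n. (1/2) ^ n + 2 ^ n * (cmod (h (Suc n) x - h n x))\<^sup>2)"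
        using s by (intro summable_add summable_geometric) auto
      fix n :: nat
      let ?d = "cmod (h (Suc n) x - h n x)"
      \<comment> \<open>With \<open>t = 2 ^ n * ?d\<close> the square yields
        \<open>t \<le> 1 + t\<^sup>2\<close>; dividing by \<open>2 ^ n\<close> bounds
        \<open>?d\<close> by a summable term.\<close>
      have "0 \<le> (1 - 2 ^ n * ?d)\<^sup>2" by simp
      then have "2 * (2 ^ n * ?d) \<le> 1 + (2 ^ n * ?d)\<^sup>2"
        by (simp add: power2_diff)
      moreover have "0 \<le> 2 ^ n * ?d" by simp
      ultimately have "2 ^ n * ?d \<le> 1 + (2 ^ n * ?d)\<^sup>2" by linarith
      then have "2 ^ n * ?d \<le> 2 ^ n * ((1/2) ^ n + 2 ^ n * ?d\<^sup>2)"
        by (simp add: power2_eq_square algebra_simps power_one_over)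
      then show "norm (h (Suc n) x - h n x) \<le> (1/2) ^ n + 2 ^ n * ?d\<^sup>2"
        by simp
    qed
    then have "convergent (\<lambda>n. (h n x - h 0 x) + h 0 x)"
      using sum_lessThan_telescope[of "\<lambda>n. h n x"] unfolding summable_iff_convergent
      by (intro convergent_add convergent_const) simp
    then show "convergent (\<lambda>n. h n x)"
      by simp
  qed
qed

text \<open>The projection is the almost everywhere limit of a minimising sequence for the distance
  to \<open>H\<close>. Fatou's lemma shows both that the limit attains the distance and that the
  convergence also holds in L^2, which puts the limit into the closed set \<open>H\<close>.\<close>

theorem orth_proj_L2_exists:
  assumes H: "closed_L2_subspace M H" and f: "square_integrable M f"
  obtains g where "orth_proj_L2 M H f g"
proof -
  have Hs: "square_integrable M h" if "h \<in> H" for h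
    using H that unfolding closed_L2_subspace_def by blast
  have Hz: "(\<lambda>x. 0) \<in> H" and Ha: "\<And>h k. h \<in> H \<Longrightarrow> k \<in> H \<Longrightarrow> (\<lambda>x. h x + k x) \<in> H"
    and Hm: "\<And>c h. h \<in> H \<Longrightarrow> (\<lambda>x. c * h x) \<in> H"
    using H unfolding closed_L2_subspace_def by blast+
  define N where "N h = (\<integral>x. (cmod (f x - h x))\<^sup>2 \<partial>M)" for h
  define D where "D = (INF h\<in>H. N h)"
  have N0: "0 \<le> N h" for h
    unfolding N_def by simp
  have bdd: "bdd_below (N ` H)"
    using N0 by (intro bdd_belowI[of _ 0]) auto
  have D: "D \<le> N h" if "h \<in> H" for h
    unfolding D_def using bdd that by (rule cINF_lower)
  \<comment> \<open>Through the parallelogram law, the excess \<open>(1/4) ^ n\<close> becomes the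
    geometric decay that almost everywhere convergence requires.\<close>
  have "\<exists>h\<in>H. N h < D + (1/4) ^ n" for n
    using cInf_lessD[of "N ` H" "D + (1/4) ^ n"] Hz by (auto simp: D_def)
  then obtain h where h: "\<And>n. h n \<in> H" "\<And>n. N (h n) < D + (1/4) ^ n"
    by metis
  \<comment> \<open>parallelogram law: the midpoint of two near-minimisers cannot beat \<open>D\<close>\<close>
  have cauchy: "(\<integral>x. (cmod (h m x - h n x))\<^sup>2 \<partial>M) \<le> 4 * (1/4) ^ n" if "n \<le> m" for n m
  proof -
    define k where "k x = 1/2 * (h n x + h m x)" for x
    have k: "k \<in> H"
      unfolding k_def by (intro Hm Ha h)
    have int: "integrable M (\<lambda>x. (cmod (f x - l x))\<^sup>2)" if "l \<in> H" for l
      using square_integrable_diff[OF f Hs[OF that]] by (simp add: square_integrable_def)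
    have "(cmod (h m x - h n x))\<^sup>2
        = 2 * (cmod (f x - h n x))\<^sup>2 + 2 * (cmod (f x - h m x))\<^sup>2 - 4 * (cmod (f x - k x))\<^sup>2" for x
      unfolding k_def cmod_power2 by (simp add: power2_eq_square field_simps)
    then have "(\<integral>x. (cmod (h m x - h n x))\<^sup>2 \<partial>M) = 2 * N (h n) + 2 * N (h m) - 4 * N k"
      using int[OF h(1)[of n]] int[OF h(1)[of m]] int[OF k] by (simp add: N_def)
    also have "\<dots> \<le> 2 * (1/4) ^ n + 2 * (1/4) ^ m"
      using h(2)[of n] h(2)[of m] D[OF k] by linarith
    also have "(1/4::real) ^ m \<le> (1/4) ^ n"
      using that by (intro power_decreasing) auto
    finally show ?thesis by simp
  qed
  have conv: "AE x in M. convergent (\<lambda>n. h n x)"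
    using Hs[OF h(1)] cauchy by (intro AE_convergent_of_fast_L2_Cauchy[where c=4]) auto
  have hm [measurable]: "h n \<in> borel_measurable M" for n
    using Hs[OF h(1)] by (simp add: square_integrable_def)
  have fm [measurable]: "f \<in> borel_measurable M"
    using f by (simp add: square_integrable_def)
  define g where "g x = lim (\<lambda>n. h n x)" for x
  have gm [measurable]: "g \<in> borel_measurable M"
    unfolding g_def by measurable
  have lim: "AE x in M. (\<lambda>n. h n x) \<longlonglongrightarrow> g x"
    using conv by eventually_elim (simp add: g_def convergent_LIMSEQ_iff)
  have q: "(\<lambda>n. (1/4::real) ^ n) \<longlonglongrightarrow> 0"
    by (intro LIMSEQ_power_zero) auto
  have "square_integrable M (\<lambda>x. f x - g x)" and Ng: "N g \<le> D"
  proof -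
    have *: "AE x in M. (\<lambda>n. f x - h n x) \<longlonglongrightarrow> f x - g x"
      using lim by eventually_elim (intro tendsto_intros)
    have "(\<lambda>n. D + (1/4) ^ n) \<longlonglongrightarrow> D"
      using tendsto_add[OF tendsto_const q, of D] by simp
    note L = integral_cmod_squared_liminf_bound[OF square_integrable_diff[OF f Hs[OF h(1)]] _ * this,
        where N=0]
    show "square_integrable M (\<lambda>x. f x - g x)"
      using h(2) by (intro L(1)) (auto simp: N_def intro: less_imp_le)
    show "N g \<le> D"
      unfolding N_def using h(2) by (intro L(2)) (auto simp: N_def intro: less_imp_le)
  qed
  then have g: "square_integrable M g"
    using square_integrable_diff[OF f] by fastforce
  \<comment> \<open>Fatou in \<open>m\<close> with \<open>n\<close> fixed: the Cauchy bound holds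
    from \<open>m = n\<close> on and survives in the limit.\<close>
  have "(\<integral>x. (cmod (h n x - g x))\<^sup>2 \<partial>M) \<le> 4 * (1/4) ^ n" for n
  proof -
    have *: "AE x in M. (\<lambda>m. h m x - h n x) \<longlonglongrightarrow> g x - h n x"
      using lim by eventually_elim (intro tendsto_intros)
    have "(\<integral>x. (cmod (g x - h n x))\<^sup>2 \<partial>M) \<le> 4 * (1/4) ^ n"
      by (rule integral_cmod_squared_liminf_bound(2)[OF square_integrable_diff[OF Hs[OF h(1)] Hs[OF h(1)]]
            _ * tendsto_const cauchy]) auto
    then show ?thesis by (simp add: norm_minus_commute)
  qed
  then have "(\<lambda>n. \<integral>x. (cmod (h n x - g x))\<^sup>2 \<partial>M) \<longlonglongrightarrow> 0"
    by (intro Lim_null_comparison[OF _ tendsto_mult_right_zero[OF q, of 4]] always_eventually allI) simp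
  then have gH: "g \<in> H"
    using H h(1) g unfolding closed_L2_subspace_def by blast
  have "(\<integral>x. (f x - g x) * cnj (k x) \<partial>M) = 0" if k: "k \<in> H" for k
  proof (rule ccontr)
    define z where "z = (\<integral>x. (f x - g x) * cnj (k x) \<partial>M)"
    assume "(\<integral>x. (f x - g x) * cnj (k x) \<partial>M) \<noteq> 0"
    then have z: "z \<noteq> 0" by (simp add: z_def)
    define K where "K = (\<integral>x. (cmod (k x))\<^sup>2 \<partial>M)"
    have K: "0 \<le> K" by (simp add: K_def)
    \<comment> \<open>Up to the \<open>+ 1\<close>, this minimises the quadratic
      \<open>N (g - c k)\<close> in \<open>c\<close>. The \<open>+ 1\<close> avoids division by zero
      when \<open>K = 0\<close> and makes the linear gain \<open>2 |z|^2 / (K + 1)\<close> exceed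
      the quadratic cost, contradicting minimality of \<open>g\<close>.\<close>
    define c where "c = - z / of_real (K + 1)"
    have fg: "square_integrable M (\<lambda>x. f x - g x)"
      by (rule square_integrable_diff[OF f g])
    have ck: "square_integrable M (\<lambda>x. c * k x)"
      by (rule square_integrable_scale[OF Hs[OF k]])
    have i: "integrable M (\<lambda>x. (f x - g x) * cnj (c * k x))"
      by (rule square_integrable_mult[OF fg ck])
    have "(\<lambda>x. g x + (- c) * k x) \<in> H"
      by (intro Ha Hm gH k)
    then have "D \<le> N (\<lambda>x. g x + (- c) * k x)"
      by (rule D)
    also have "\<dots> = (\<integral>x. (cmod ((f x - g x) + c * k x))\<^sup>2 \<partial>M)"
      unfolding N_def by (simp add: algebra_simps)
    also have "\<dots> = (\<integral>x. (cmod (f x - g x))\<^sup>2 + 2 * Re ((f x - g x) * cnj (c * k x)) + (cmod (c * k x))\<^sup>2 \<partial>M)"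
      by (simp only: cmod_add_squared)
    also have "\<dots> = N g + 2 * (\<integral>x. Re ((f x - g x) * cnj (c * k x)) \<partial>M) + (\<integral>x. (cmod (c * k x))\<^sup>2 \<partial>M)"
      using fg ck integrable_Re[OF i] by (simp add: N_def square_integrable_def del: times_complex.sel complex_cnj_mult)
    also have "(\<integral>x. Re ((f x - g x) * cnj (c * k x)) \<partial>M) = Re (\<integral>x. (f x - g x) * cnj (c * k x) \<partial>M)"
      using i by (rule integral_Re)
    also have "(\<integral>x. (f x - g x) * cnj (c * k x) \<partial>M) = cnj c * z"
      unfolding z_def by (simp flip: integral_mult_right_zero add: ac_simps)
    also have "Re (cnj c * z) = - (cmod z)\<^sup>2 / (K + 1)"
    proof -
      have "cnj c * z = - (of_real ((cmod z)\<^sup>2) / of_real (K + 1))"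
        unfolding c_def complex_norm_square by (simp add: mult.commute)
      then show ?thesis
        by (simp flip: of_real_divide of_real_minus del: of_real_add)
    qed
    also have "(\<integral>x. (cmod (c * k x))\<^sup>2 \<partial>M) = (cmod z)\<^sup>2 / (K + 1)\<^sup>2 * K"
    proof -
      have "cmod c = cmod z / (K + 1)"
        unfolding c_def norm_divide norm_minus_cancel norm_of_real using K by simp
      then show ?thesis
        by (simp add: K_def norm_mult power_mult_distrib power_divide)
    qed
    finally have "2 * (cmod z)\<^sup>2 / (K + 1) \<le> (cmod z)\<^sup>2 / (K + 1)\<^sup>2 * K"
      using Ng by simp
    moreover have "(cmod z)\<^sup>2 / (K + 1)\<^sup>2 * K \<le> (cmod z)\<^sup>2 / (K + 1)\<^sup>2 * (K + 1)"
      by (intro mult_left_mono) auto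
    moreover have "(cmod z)\<^sup>2 / (K + 1)\<^sup>2 * (K + 1) = (cmod z)\<^sup>2 / (K + 1)"
      using K by (simp add: power2_eq_square)
    moreover have "0 < (cmod z)\<^sup>2 / (K + 1)"
      using z K by simp
    ultimately show False by simp
  qed
  then show thesis
    using that gH by (auto simp: orth_proj_L2_def)
qed

lemma L2_imp_L1:
  assumes "finite_measure M" "square_integrable M f"
  shows "integrable M f"
proof -
  have f: "f \<in> borel_measurable M" "integrable M (\<lambda>x. (cmod (f x))\<^sup>2)"
    using assms by (auto simp: square_integrable_def)
  have "(\<lambda>x. cmod (f x)) \<in> borel_measurable M"
    using f(1) by measurable
  from finite_measure.square_integrable_imp_integrable[OF assms(1) this f(2)]
  show ?thesis
    using f(1) by (rule integrable_norm_cancel)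
qed

text \<open>Square integrability makes both products integrable, so the orthogonality relation can
  be split. The factor \<open>cnj (h x)\<close> stands in front so that it can serve as a weak-*
  test function.\<close>

lemma orth_proj_L2_inner:
  assumes H: "closed_L2_subspace M H" and f: "square_integrable M f"
    and g: "orth_proj_L2 M H f g" and h: "h \<in> H"
  shows "(\<integral>x. cnj (h x) * g x \<partial>M) = (\<integral>x. cnj (h x) * f x \<partial>M)"
proof -
  have orth: "(\<integral>x. (f x - g x) * cnj (h x) \<partial>M) = 0" and "g \<in> H"
    using g h unfolding orth_proj_L2_def by blast+
  then have gh: "square_integrable M g" "square_integrable M h"
    using H h unfolding closed_L2_subspace_def by blast+
  have "(\<integral>x. f x * cnj (h x) \<partial>M) - (\<integral>x. g x * cnj (h x) \<partial>M) = 0"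
    unfolding orth[symmetric] left_diff_distrib
    by (rule Bochner_Integration.integral_diff[symmetric])
      (rule square_integrable_mult[OF f gh(2)], rule square_integrable_mult[OF gh])
  then show ?thesis
    by (subst (1 2) mult.commute) simp
qed

section \<open>Riesz representation on compact Hausdorff spaces\<close>

text \<open>No support condition is imposed on \<open>f\<close>: replacing \<open>f\<close> by the positive part of \<open>f - d\<close> yields a
  compact support inside \<open>U\<close> at arbitrarily small cost.\<close>

definition subordinate :: "'a::topological_space set \<Rightarrow> ('a \<Rightarrow> real) set" where
  "subordinate U = {f. continuous_on UNIV f \<and> (\<forall>x. 0 \<le> f x \<and> f x \<le> indicator U x)}"

text \<open>The value on open sets in the classical construction of the Riesz measure. The supremum
  is taken in \<open>ennreal\<close>, where it exists before any bound is known.\<close>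

definition open_content :: "(('a::topological_space \<Rightarrow> real) \<Rightarrow> real) \<Rightarrow> 'a set \<Rightarrow> ennreal" where
  "open_content \<Lambda> U = (SUP f\<in>subordinate U. ennreal (\<Lambda> f))"

definition outer_content :: "(('a::topological_space \<Rightarrow> real) \<Rightarrow> real) \<Rightarrow> 'a set \<Rightarrow> ennreal" where
  "outer_content \<Lambda> E = (INF U\<in>{U. open U \<and> E \<subseteq> U}. open_content \<Lambda> U)"

text \<open>\<open>measure_of\<close> falls back to the zero measure when its set function is not a
  measure, so this is total in \<open>\<Lambda>\<close>; \<open>emeasure_riesz_measure\<close> shows
  that positive functionals avoid the fallback.\<close>

definition riesz_measure :: "(('a::topological_space \<Rightarrow> real) \<Rightarrow> real) \<Rightarrow> 'a measure" where
  "riesz_measure \<Lambda> = measure_of UNIV (sets borel) (outer_content \<Lambda>)"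

lemma sets_riesz_measure [simp, measurable_cong]: "sets (riesz_measure \<Lambda>) = sets borel"
  unfolding riesz_measure_def using sets.sigma_sets_eq[of borel] by (simp add: sets_measure_of)

lemma space_riesz_measure [simp]: "space (riesz_measure \<Lambda>) = UNIV"
  by (simp add: riesz_measure_def)

section \<open>Elementary properties of the contents\<close>

lemma subordinate_zero: "(\<lambda>x. 0) \<in> subordinate U"
  by (simp add: subordinate_def)

lemma subordinate_mono:
  assumes "U \<subseteq> V"
  shows "subordinate U \<subseteq> subordinate V"
proof -
  have "indicat_real U x \<le> indicator V x" for x
    using assms by (intro indicator_leI) auto
  then show ?thesis
    unfolding subordinate_def by (auto intro: order_trans)
qed

lemma subordinate_outside: "f \<in> subordinate U \<Longrightarrow> x \<notin> U \<Longrightarrow> f x = 0"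
  unfolding subordinate_def by (metis (mono_tags) order_antisym indicator_simps(2) mem_Collect_eq)

lemma subordinate_le_1: "f \<in> subordinate U \<Longrightarrow> f x \<le> 1"
  unfolding subordinate_def by (metis (mono_tags) indicator_le_1 mem_Collect_eq order_trans)

lemma open_content_mono: "U \<subseteq> V \<Longrightarrow> open_content \<Lambda> U \<le> open_content \<Lambda> V"
  unfolding open_content_def using subordinate_mono by (intro SUP_subset_mono) auto

lemma outer_content_open: "open U \<Longrightarrow> outer_content \<Lambda> U = open_content \<Lambda> U"
  unfolding outer_content_def
  by (rule antisym) (auto intro!: INF_lower INF_greatest open_content_mono)

lemma outer_content_mono: "E \<subseteq> F \<Longrightarrow> outer_content \<Lambda> E \<le> outer_content \<Lambda> F"
  unfolding outer_content_def by (intro INF_superset_mono) auto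

lemma outer_content_le_open: "open U \<Longrightarrow> E \<subseteq> U \<Longrightarrow> outer_content \<Lambda> E \<le> open_content \<Lambda> U"
  unfolding outer_content_def by (auto intro!: INF_lower)

text \<open>Compactness upgrades Hausdorff to normal, which is what Urysohn's lemma
  requires.\<close>

lemma compact_T2_Urysohn:
  fixes S T :: "'a::t2_space set"
  assumes "compact (UNIV :: 'a set)" "closed S" "closed T" "S \<inter> T = {}"
  obtains g :: "'a \<Rightarrow> real" where "continuous_on UNIV g" "\<And>x. 0 \<le> g x" "\<And>x. g x \<le> 1"
    "\<And>x. x \<in> S \<Longrightarrow> g x = 0" "\<And>x. x \<in> T \<Longrightarrow> g x = 1"
proof -
  have "Hausdorff_space (euclidean :: 'a topology)"
    unfolding Hausdorff_space_def disjnt_def using hausdorff by (simp, blast)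
  then have "normal_space (euclidean :: 'a topology)"
    using assms(1) by (intro compact_Hausdorff_or_regular_imp_normal_space)
      (auto simp: compact_space_def)
  then obtain g where g: "continuous_map euclidean (top_of_set {0..1::real}) g"
      "g ` S \<subseteq> {0}" "g ` T \<subseteq> {1}"
    using Urysohn_lemma[of euclidean S T 0 1] assms by (auto simp: disjnt_def)
  show thesis
  proof (rule that[of g])
    show "continuous_on UNIV g"
      using g(1) by (auto simp: continuous_map_in_subtopology)
  qed (use g in \<open>auto simp: continuous_map_in_subtopology\<close>)
qed

lemma continuous_on_compact_bounded:
  fixes \<phi> :: "'a::topological_space \<Rightarrow> 'b::real_normed_vector"
  assumes "compact (UNIV :: 'a set)" "continuous_on UNIV \<phi>"
  obtains B where "\<And>x. norm (\<phi> x) \<le> B"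
proof -
  have "bounded (range \<phi>)"
    using assms compact_continuous_image compact_imp_bounded by blast
  then show thesis
    using that by (auto simp: bounded_iff)
qed

section \<open>Positive functionals and subadditivity on open sets\<close>

locale positive_functional =
  fixes \<Lambda> :: "('a::t2_space \<Rightarrow> real) \<Rightarrow> real"
  assumes compact_space: "compact (UNIV :: 'a set)"
    and add: "\<And>f g. continuous_on UNIV f \<Longrightarrow> continuous_on UNIV g \<Longrightarrow>
               \<Lambda> (\<lambda>x. f x + g x) = \<Lambda> f + \<Lambda> g"
    and scale: "\<And>c f. continuous_on UNIV f \<Longrightarrow> \<Lambda> (\<lambda>x. c * f x) = c * \<Lambda> f"
    and nonneg: "\<And>f. continuous_on UNIV f \<Longrightarrow> (\<And>x. 0 \<le> f x) \<Longrightarrow> 0 \<le> \<Lambda> f"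
begin

lemma diff:
  assumes "continuous_on UNIV f" "continuous_on UNIV g"
  shows "\<Lambda> (\<lambda>x. f x - g x) = \<Lambda> f - \<Lambda> g"
  using add[of f "\<lambda>x. - 1 * g x"] scale[of g "- 1"] assms
  by (simp add: continuous_on_minus)

lemma mono:
  assumes "continuous_on UNIV f" "continuous_on UNIV g" "\<And>x. f x \<le> g x"
  shows "\<Lambda> f \<le> \<Lambda> g"
  using nonneg[of "\<lambda>x. g x - f x"] diff[of g f] assms
  by (auto intro: continuous_intros)

lemma sum:
  assumes "finite I" "\<And>i. i \<in> I \<Longrightarrow> continuous_on UNIV (f i)"
  shows "\<Lambda> (\<lambda>x. \<Sum>i\<in>I. f i x) = (\<Sum>i\<in>I. \<Lambda> (f i))"
  using assms
proof (induction I rule: finite_induct)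
  case empty
  then show ?case using scale[of "\<lambda>x. 0" 0] by simp
next
  case (insert i I)
  then show ?case
    by (simp add: add continuous_on_sum)
qed

lemma const: "\<Lambda> (\<lambda>x. c) = c * \<Lambda> (\<lambda>x. 1)"
  using scale[of "\<lambda>x. 1" c] by simp

text \<open>The pointwise bound \<open>f \<le> max 0 (f - d) + d\<close> loses at most
  \<open>d * \<Lambda> (\<lambda>x. 1)\<close>. The gain is a function that vanishes off the closed
  set where \<open>d \<le> f\<close>.\<close>

lemma truncate:
  assumes f: "continuous_on UNIV f" and "e > 0"
  obtains d where "d > 0" "\<Lambda> f \<le> \<Lambda> (\<lambda>x. max 0 (f x - d)) + e"
proof -
  have 1: "0 \<le> \<Lambda> (\<lambda>x. 1)" by (rule nonneg) auto
  define d where "d = e / (\<Lambda> (\<lambda>x. 1) + 1)"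
  have d: "d > 0" "d * \<Lambda> (\<lambda>x. 1) \<le> e"
    using 1 \<open>e > 0\<close> by (auto simp: d_def field_simps)
  have c: "continuous_on UNIV (\<lambda>x. max 0 (f x - d))"
    using f by (intro continuous_intros)
  have "\<Lambda> f \<le> \<Lambda> (\<lambda>x. max 0 (f x - d) + d)"
    using f by (intro mono continuous_intros) auto
  also have "\<dots> = \<Lambda> (\<lambda>x. max 0 (f x - d)) + d * \<Lambda> (\<lambda>x. 1)"
    using c const[of d] by (subst add) auto
  finally show thesis using that d by force
qed

lemma ennreal_truncate:
  assumes f: "continuous_on UNIV f" and "e > 0"
  obtains d where "d > 0" "ennreal (\<Lambda> f) \<le> ennreal (\<Lambda> (\<lambda>x. max 0 (f x - d))) + ennreal e"
proof -
  obtain d where d: "d > 0" "\<Lambda> f \<le> \<Lambda> (\<lambda>x. max 0 (f x - d)) + e"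
    using truncate[OF assms] .
  have "0 \<le> \<Lambda> (\<lambda>x. max 0 (f x - d))"
    using f by (intro nonneg continuous_intros) auto
  then show thesis
    using that[OF d(1)] d(2) \<open>e > 0\<close> by (simp flip: ennreal_plus)
qed

text \<open>After truncation only a closed set \<open>K\<close> inside \<open>U \<union> V\<close>
  matters. A Urysohn function separating \<open>K - U\<close> from \<open>K - V\<close> acts as a
  partition of unity and splits the truncated function between \<open>U\<close> and
  \<open>V\<close>.\<close>

lemma open_content_Un:
  assumes "open U" "open V"
  shows "open_content \<Lambda> (U \<union> V) \<le> open_content \<Lambda> U + open_content \<Lambda> V"
  unfolding open_content_def[of _ "U \<union> V"]
proof (rule SUP_least, rule ennreal_le_epsilon)
  fix f and e :: real
  assume f: "f \<in> subordinate (U \<union> V)" and "0 < e"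
  have fc: "continuous_on UNIV f"
    using f by (auto simp: subordinate_def)
  obtain d where d: "d > 0" "ennreal (\<Lambda> f) \<le> ennreal (\<Lambda> (\<lambda>x. max 0 (f x - d))) + ennreal e"
    using ennreal_truncate[OF fc \<open>0 < e\<close>] .
  define K where "K = {x. d \<le> f x}"
  have K: "closed K"
    unfolding K_def using fc by (intro closed_Collect_le continuous_intros)
  have "K \<subseteq> U \<union> V"
    using d subordinate_outside[OF f] by (force simp: K_def)
  then have "(K - U) \<inter> (K - V) = {}" by auto
  then obtain g where g: "continuous_on UNIV g" "\<And>x. 0 \<le> g x" "\<And>x. g x \<le> 1"
      "\<And>x. x \<in> K - U \<Longrightarrow> g x = 0" "\<And>x. x \<in> K - V \<Longrightarrow> g x = (1::real)"
    using compact_T2_Urysohn[OF compact_space, of "K - U" "K - V"] K assms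
    by (metis closed_Diff)
  let ?f = "\<lambda>x. max 0 (f x - d)"
  have f'1: "?f x \<le> 1" for x
    using subordinate_le_1[OF f, of x] d(1) by simp
  have off: "?f x = 0" if "x \<notin> K" for x
    using that by (auto simp: K_def)
  have p: "(\<lambda>x. ?f x * g x) \<in> subordinate U"
    unfolding subordinate_def
  proof (safe intro!: continuous_intros fc g(1))
    fix x show "0 \<le> ?f x * g x" using g(2)[of x] by simp
    show "?f x * g x \<le> indicator U x"
      using f'1[of x] g(2,3)[of x] g(4)[of x] off[of x]
      by (cases "x \<in> U"; cases "x \<in> K") (auto intro: mult_le_one)
  qed
  have q: "(\<lambda>x. ?f x * (1 - g x)) \<in> subordinate V"
    unfolding subordinate_def
  proof (safe intro!: continuous_intros fc g(1))
    fix x show "0 \<le> ?f x * (1 - g x)" using g(3)[of x] by simp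
    show "?f x * (1 - g x) \<le> indicator V x"
      using f'1[of x] g(2,3)[of x] g(5)[of x] off[of x]
      by (cases "x \<in> V"; cases "x \<in> K") (auto intro: mult_le_one)
  qed
  have "\<Lambda> ?f = \<Lambda> (\<lambda>x. ?f x * g x + ?f x * (1 - g x))"
    by (simp add: algebra_simps)
  also have "\<dots> = \<Lambda> (\<lambda>x. ?f x * g x) + \<Lambda> (\<lambda>x. ?f x * (1 - g x))"
    by (intro add continuous_intros fc g(1))
  finally have "ennreal (\<Lambda> ?f) = ennreal (\<Lambda> (\<lambda>x. ?f x * g x)) + ennreal (\<Lambda> (\<lambda>x. ?f x * (1 - g x)))"
    using p q by (simp add: ennreal_plus nonneg subordinate_def)
  also have "\<dots> \<le> open_content \<Lambda> U + open_content \<Lambda> V"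
    unfolding open_content_def using p q by (intro add_mono SUP_upper)
  finally show "ennreal (\<Lambda> f) \<le> open_content \<Lambda> U + open_content \<Lambda> V + ennreal e"
    using d(2) by (meson add_right_mono order_trans)
qed

lemma open_content_empty: "open_content \<Lambda> {} = 0"
proof -
  have "subordinate {} = {\<lambda>x::'a. 0}"
    using subordinate_outside[of _ "{}"] subordinate_zero[of "{}"] by auto
  then show ?thesis
    using const[of 0] by (simp add: open_content_def)
qed

lemma open_content_finite_UN:
  fixes U :: "nat \<Rightarrow> 'a set"
  assumes "\<And>n. open (U n)"
  shows "open_content \<Lambda> (\<Union>i<n. U i) \<le> (\<Sum>i<n. open_content \<Lambda> (U i))"
proof (induction n)
  case 0
  then show ?case by (simp add: open_content_empty)
next
  case (Suc n)
  have "open_content \<Lambda> (\<Union>i<Suc n. U i) \<le> open_content \<Lambda> (\<Union>i<n. U i) + open_content \<Lambda> (U n)"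
    using open_content_Un[of "\<Union>i<n. U i" "U n"] assms
    by (simp add: lessThan_Suc Un_commute open_UN)
  also have "\<dots> \<le> (\<Sum>i<Suc n. open_content \<Lambda> (U i))"
    using Suc by (simp add: add_right_mono)
  finally show ?case .
qed

text \<open>Truncation leaves a function living on a compact set, so finitely many of the
  \<open>U i\<close> already cover it and finite subadditivity applies.\<close>

lemma open_content_countable_UN:
  fixes U :: "nat \<Rightarrow> 'a set"
  assumes "\<And>n. open (U n)"
  shows "open_content \<Lambda> (\<Union>i. U i) \<le> (\<Sum>i. open_content \<Lambda> (U i))"
  unfolding open_content_def[of _ "\<Union>i. U i"]
proof (rule SUP_least, rule ennreal_le_epsilon)
  fix f and e :: real
  assume f: "f \<in> subordinate (\<Union>i. U i)" and "0 < e"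
  have fc: "continuous_on UNIV f"
    using f by (auto simp: subordinate_def)
  obtain d where d: "d > 0" "ennreal (\<Lambda> f) \<le> ennreal (\<Lambda> (\<lambda>x. max 0 (f x - d))) + ennreal e"
    using ennreal_truncate[OF fc \<open>0 < e\<close>] .
  define K where "K = {x. d \<le> f x}"
  have "closed K"
    unfolding K_def using fc by (intro closed_Collect_le continuous_intros)
  then have "compact K"
    using compact_space compact_Int_closed[of UNIV K] by simp
  moreover have "K \<subseteq> (\<Union>i. U i)"
    using d subordinate_outside[OF f] by (force simp: K_def)
  ultimately obtain I where I: "finite I" "K \<subseteq> (\<Union>i\<in>I. U i)"
    using compactE_image[of K UNIV U] assms by auto
  obtain n where "I \<subseteq> {..<n}"
    using finite_nat_bounded[OF I(1)] by auto
  then have K: "K \<subseteq> (\<Union>i<n. U i)"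
    using I(2) by blast
  have "(\<lambda>x. max 0 (f x - d)) \<in> subordinate (\<Union>i<n. U i)"
    unfolding subordinate_def
  proof (safe intro!: continuous_intros fc)
    fix x
    have "f x \<le> 1"
      using f by (rule subordinate_le_1)
    then show "max 0 (f x - d) \<le> indicator (\<Union>i<n. U i) x"
      using d K by (cases "x \<in> K") (auto simp: K_def indicator_def)
  qed auto
  then have "ennreal (\<Lambda> (\<lambda>x. max 0 (f x - d))) \<le> open_content \<Lambda> (\<Union>i<n. U i)"
    unfolding open_content_def by (rule SUP_upper)
  also have "\<dots> \<le> (\<Sum>i<n. open_content \<Lambda> (U i))"
    using assms by (rule open_content_finite_UN)
  also have "\<dots> \<le> (\<Sum>i. open_content \<Lambda> (U i))"
    by (intro sum_le_suminf) auto
  finally show "ennreal (\<Lambda> f) \<le> (\<Sum>i. open_content \<Lambda> (U i)) + ennreal e"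
    using d(2) by (meson add_right_mono order_trans)
qed

section \<open>Outer measure and Caratheodory's construction\<close>

lemma outer_measure_space_outer_content: "outer_measure_space (Pow UNIV) (outer_content \<Lambda>)"
  unfolding outer_measure_space_def
proof (intro conjI)
  show "positive (Pow UNIV) (outer_content \<Lambda>)"
    by (simp add: positive_def outer_content_open open_content_empty)
  show "increasing (Pow UNIV) (outer_content \<Lambda>)"
    by (simp add: increasing_def outer_content_mono)
  show "countably_subadditive (Pow UNIV) (outer_content \<Lambda>)"
    unfolding countably_subadditive_def
  proof safe
    fix A :: "nat \<Rightarrow> 'a set"
    show "outer_content \<Lambda> (\<Union>i. A i) \<le> (\<Sum>n. outer_content \<Lambda> (A n))"
    proof (rule ennreal_le_epsilon)
      fix e :: real assume "0 < e" "(\<Sum>n. outer_content \<Lambda> (A n)) < top"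
      \<comment> \<open>A finite sum has finite terms, so a positive slack is a strict increase and
        some open superset fits below it. The slacks \<open>e * (1/2)^Suc n\<close> add up to
        \<open>e\<close>.\<close>
      then have "\<And>n. outer_content \<Lambda> (A n) < outer_content \<Lambda> (A n) + e * (1/2)^Suc n"
        by (auto simp add: less_top dest!: ennreal_suminf_lessD)
      then have "\<forall>n. \<exists>U. open U \<and> A n \<subseteq> U \<and> open_content \<Lambda> U \<le> outer_content \<Lambda> (A n) + e * (1/2)^Suc n"
        by (subst (asm) (1) outer_content_def) (force simp: INF_less_iff intro: less_imp_le)
      then obtain U where U: "\<And>n. open (U n)" "\<And>n. A n \<subseteq> U n"
          "\<And>n. open_content \<Lambda> (U n) \<le> outer_content \<Lambda> (A n) + e * (1/2)^Suc n"
        by metis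
      have "outer_content \<Lambda> (\<Union>i. A i) \<le> open_content \<Lambda> (\<Union>i. U i)"
        using U by (intro outer_content_le_open) auto
      also have "\<dots> \<le> (\<Sum>i. open_content \<Lambda> (U i))"
        using U by (intro open_content_countable_UN)
      also have "\<dots> \<le> (\<Sum>n. outer_content \<Lambda> (A n) + e * (1/2) ^ Suc n)"
        by (intro suminf_le allI U) auto
      also have "... = (\<Sum>n. outer_content \<Lambda> (A n)) + (\<Sum>n. ennreal e * ennreal ((1/2) ^ Suc n))"
        using \<open>0 < e\<close> by (subst suminf_add[symmetric])
           (auto simp del: ennreal_suminf_cmult simp add: ennreal_mult[symmetric])
      also have "\<dots> = (\<Sum>n. outer_content \<Lambda> (A n)) + e"
        unfolding ennreal_suminf_cmult
        by (subst suminf_ennreal_eq[OF zero_le_power power_half_series]) auto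
      finally show "outer_content \<Lambda> (\<Union>i. A i) \<le> (\<Sum>n. outer_content \<Lambda> (A n)) + e" .
    qed
  qed
qed

text \<open>For \<open>f\<close> subordinate to \<open>W \<inter> U\<close>, the truncation of
  \<open>f\<close> vanishes off a closed set \<open>K\<close> inside \<open>W \<inter> U\<close>.
  Functions subordinate to the open set \<open>W - K\<close>, which contains \<open>E - U\<close>,
  can therefore be added to it without exceeding the indicator of \<open>W\<close>.\<close>

lemma open_content_split:
  assumes "open U" "open W" "E \<subseteq> W"
  shows "open_content \<Lambda> (W \<inter> U) + outer_content \<Lambda> (E - U) \<le> open_content \<Lambda> W"
proof -
  have "ennreal (\<Lambda> f) + outer_content \<Lambda> (E - U) \<le> open_content \<Lambda> W"
    if f: "f \<in> subordinate (W \<inter> U)" for f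
  proof (rule ennreal_le_epsilon)
    fix e :: real assume "0 < e"
    have fc: "continuous_on UNIV f"
      using f by (auto simp: subordinate_def)
    obtain d where d: "d > 0" "ennreal (\<Lambda> f) \<le> ennreal (\<Lambda> (\<lambda>x. max 0 (f x - d))) + ennreal e"
      using ennreal_truncate[OF fc \<open>0 < e\<close>] .
    let ?f = "\<lambda>x. max 0 (f x - d)"
    define K where "K = {x. d \<le> f x}"
    have "closed K"
      unfolding K_def using fc by (intro closed_Collect_le continuous_intros)
    have KU: "K \<subseteq> W \<inter> U"
      using d subordinate_outside[OF f] by (force simp: K_def)
    have *: "ennreal (\<Lambda> ?f) + ennreal (\<Lambda> g) \<le> open_content \<Lambda> W" if g: "g \<in> subordinate (W - K)" for g
    proof -
      have gc: "continuous_on UNIV g" and g0: "\<And>x. 0 \<le> g x" and g1: "\<And>x. g x \<le> indicator (W - K) x"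
        using g by (auto simp: subordinate_def)
      have "(\<lambda>x. ?f x + g x) \<in> subordinate W"
        unfolding subordinate_def
      proof (safe intro!: continuous_intros fc gc)
        fix x
        show "0 \<le> ?f x + g x" using g0[of x] by simp
        have "f x \<le> 1"
          using f by (rule subordinate_le_1)
        then show "?f x + g x \<le> indicator W x"
          using d KU g1[of x] subordinate_outside[OF g, of x] subordinate_le_1[OF g, of x]
          by (cases "x \<in> K"; cases "x \<in> W") (auto simp: K_def)
      qed
      moreover have "\<Lambda> (\<lambda>x. ?f x + g x) = \<Lambda> ?f + \<Lambda> g"
        by (intro add continuous_intros fc gc)
      moreover have "0 \<le> \<Lambda> ?f" "0 \<le> \<Lambda> g"
        using g0 by (auto intro!: nonneg continuous_intros fc gc)
      ultimately show ?thesis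
        unfolding open_content_def by (auto intro!: SUP_upper2 simp flip: ennreal_plus)
    qed
    have "outer_content \<Lambda> (E - U) \<le> open_content \<Lambda> (W - K)"
      using assms KU \<open>closed K\<close> by (intro outer_content_le_open) auto
    then have "ennreal (\<Lambda> ?f) + outer_content \<Lambda> (E - U) \<le> ennreal (\<Lambda> ?f) + open_content \<Lambda> (W - K)"
      by (rule add_left_mono)
    \<comment> \<open>A constant moves into a supremum over a nonempty set; the zero function is the
      member.\<close>
    also have "\<dots> = (SUP g\<in>subordinate (W - K). ennreal (\<Lambda> ?f) + ennreal (\<Lambda> g))"
      unfolding open_content_def using subordinate_zero by (subst ennreal_SUP_add_right) auto
    also have "\<dots> \<le> open_content \<Lambda> W"
      using * by (rule SUP_least)
    finally have **: "ennreal (\<Lambda> ?f) + outer_content \<Lambda> (E - U) \<le> open_content \<Lambda> W" .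
    have "ennreal (\<Lambda> f) + outer_content \<Lambda> (E - U)
        \<le> ennreal (\<Lambda> ?f) + ennreal e + outer_content \<Lambda> (E - U)"
      using d(2) by (rule add_right_mono)
    also have "\<dots> = ennreal (\<Lambda> ?f) + outer_content \<Lambda> (E - U) + ennreal e"
      by (simp add: ac_simps)
    also have "\<dots> \<le> open_content \<Lambda> W + ennreal e"
      using ** by (rule add_right_mono)
    finally show "ennreal (\<Lambda> f) + outer_content \<Lambda> (E - U) \<le> open_content \<Lambda> W + ennreal e" .
  qed
  then have "(SUP f\<in>subordinate (W \<inter> U). ennreal (\<Lambda> f) + outer_content \<Lambda> (E - U)) \<le> open_content \<Lambda> W"
    by (rule SUP_least)
  then show ?thesis
    unfolding open_content_def[of _ "W \<inter> U"] using subordinate_zero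
    by (subst (asm) ennreal_SUP_add_left) auto
qed

text \<open>Caratheodory's criterion for open sets. One inequality passes from open supersets
  \<open>W\<close> to their infimum; the other is subadditivity of the outer measure.\<close>

lemma outer_content_split:
  assumes "open U"
  shows "outer_content \<Lambda> (E \<inter> U) + outer_content \<Lambda> (E - U) = outer_content \<Lambda> E"
proof (rule antisym)
  show "outer_content \<Lambda> (E \<inter> U) + outer_content \<Lambda> (E - U) \<le> outer_content \<Lambda> E"
    unfolding outer_content_def[of _ E]
  proof (rule INF_greatest, safe)
    fix W assume "open W" "E \<subseteq> W"
    have "outer_content \<Lambda> (E \<inter> U) \<le> open_content \<Lambda> (W \<inter> U)"
      using \<open>open W\<close> \<open>E \<subseteq> W\<close> assms by (intro outer_content_le_open) auto
    then show "outer_content \<Lambda> (E \<inter> U) + outer_content \<Lambda> (E - U) \<le> open_content \<Lambda> W"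
      using open_content_split[OF assms \<open>open W\<close> \<open>E \<subseteq> W\<close>] by (meson add_right_mono order_trans)
  qed
next
  interpret P: algebra UNIV "Pow (UNIV :: 'a set)" by (rule algebra_Pow)
  have "subadditive (Pow UNIV) (outer_content \<Lambda>)"
    using outer_measure_space_outer_content unfolding outer_measure_space_def
    by (blast intro: P.countably_subadditive_subadditive)
  then have "outer_content \<Lambda> ((E \<inter> U) \<union> (E - U)) \<le> outer_content \<Lambda> (E \<inter> U) + outer_content \<Lambda> (E - U)"
    by (intro subadditiveD) auto
  then show "outer_content \<Lambda> E \<le> outer_content \<Lambda> (E \<inter> U) + outer_content \<Lambda> (E - U)"
    by (simp add: Int_Diff_Un)
qed

text \<open>The Caratheodory measurable sets form a sigma-algebra on which the outer content is
  countably additive. It contains the open sets, hence all Borel sets, so \<open>measure_of\<close>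
  keeps its set function.\<close>

lemma emeasure_riesz_measure:
  assumes "E \<in> sets borel"
  shows "emeasure (riesz_measure \<Lambda>) E = outer_content \<Lambda> E"
proof -
  interpret P: sigma_algebra UNIV "Pow (UNIV :: 'a set)" by (rule sigma_algebra_Pow)
  let ?L = "lambda_system UNIV (Pow (UNIV :: 'a set)) (outer_content \<Lambda>)"
  have L: "measure_space UNIV ?L (outer_content \<Lambda>)"
    by (rule P.caratheodory_lemma[OF outer_measure_space_outer_content])
  interpret L: sigma_algebra UNIV ?L
    using L by (simp add: measure_space_def)
  have "{U. open U} \<subseteq> ?L"
    unfolding P.lambda_system_eq using outer_content_split by simp blast
  then have "sigma_sets UNIV {U. open U} \<subseteq> ?L"
    by (rule L.sigma_sets_subset)
  then have sub: "sets borel \<subseteq> ?L"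
    by (simp add: borel_def)
  have "countably_additive (sets borel) (outer_content \<Lambda>)"
    unfolding countably_additive_def
  proof safe
    fix A :: "nat \<Rightarrow> 'a set"
    assume A: "range A \<subseteq> sets borel" "disjoint_family A" "(\<Union>i. A i) \<in> sets borel"
    then show "(\<Sum>i. outer_content \<Lambda> (A i)) = outer_content \<Lambda> (\<Union>i. A i)"
      using L sub unfolding measure_space_def countably_additive_def by (meson subset_trans subsetD)
  qed
  moreover have "positive (sets borel) (outer_content \<Lambda>)"
    by (simp add: positive_def outer_content_open open_content_empty)
  ultimately show ?thesis
    unfolding riesz_measure_def
    using emeasure_measure_of_sigma[OF _ _ _ assms, of UNIV] sets.sigma_algebra_axioms[of borel]
    by simp
qed

section \<open>Total mass and regularity of the Riesz measure\<close>

lemma emeasure_riesz_measure_UNIV: "emeasure (riesz_measure \<Lambda>) UNIV = ennreal (\<Lambda> (\<lambda>x. 1))"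
proof -
  have "open_content \<Lambda> UNIV = ennreal (\<Lambda> (\<lambda>x. 1))"
    unfolding open_content_def
  proof (rule antisym)
    show "(SUP f\<in>subordinate UNIV. ennreal (\<Lambda> f)) \<le> ennreal (\<Lambda> (\<lambda>x. 1))"
      by (auto intro!: SUP_least ennreal_leI mono simp: subordinate_def)
    show "ennreal (\<Lambda> (\<lambda>x. 1)) \<le> (SUP f\<in>subordinate UNIV. ennreal (\<Lambda> f))"
      by (rule SUP_upper) (auto simp: subordinate_def)
  qed
  then show ?thesis
    by (simp add: emeasure_riesz_measure outer_content_open)
qed

sublocale riesz: finite_measure "riesz_measure \<Lambda>"
  by standard (simp add: emeasure_riesz_measure_UNIV)

text \<open>Outer regularity is built into \<open>outer_content\<close>. As the total mass is
  finite, complements turn it into inner regularity by closed sets, which are compact here.\<close>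

lemma finite_regular_borel_riesz_measure: "finite_regular_borel (riesz_measure \<Lambda>)"
  unfolding finite_regular_borel_def
proof (intro conjI ballI)
  fix E :: "'a set" assume E: "E \<in> sets borel"
  have outer: "emeasure (riesz_measure \<Lambda>) F = (INF U\<in>{U. open U \<and> F \<subseteq> U}. emeasure (riesz_measure \<Lambda>) U)"
    if "F \<in> sets borel" for F
    unfolding emeasure_riesz_measure[OF that] outer_content_def
    by (intro INF_cong) (auto simp: emeasure_riesz_measure outer_content_open)
  then show "emeasure (riesz_measure \<Lambda>) E = (INF U\<in>{U. open U \<and> E \<subseteq> U}. emeasure (riesz_measure \<Lambda>) U)"
    using E .
  let ?\<nu> = "riesz_measure \<Lambda>"
  show "emeasure ?\<nu> E = (SUP K\<in>{K. compact K \<and> K \<subseteq> E}. emeasure ?\<nu> K)"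
  proof (rule antisym)
    show "(SUP K\<in>{K. compact K \<and> K \<subseteq> E}. emeasure ?\<nu> K) \<le> emeasure ?\<nu> E"
      using E by (auto intro!: SUP_least emeasure_mono)
    have co: "emeasure ?\<nu> (- F) = emeasure ?\<nu> UNIV - emeasure ?\<nu> F" if "F \<in> sets borel" for F
      using emeasure_compl[of F ?\<nu>] that by (simp add: Compl_eq_Diff_UNIV)
    have "emeasure ?\<nu> E = emeasure ?\<nu> UNIV - emeasure ?\<nu> (- E)"
      using co[of "- E"] E by simp
    also have "\<dots> = emeasure ?\<nu> UNIV - (INF U\<in>{U. open U \<and> - E \<subseteq> U}. emeasure ?\<nu> U)"
      using outer[of "- E"] E by simp
    also have "\<dots> = (SUP U\<in>{U. open U \<and> - E \<subseteq> U}. emeasure ?\<nu> UNIV - emeasure ?\<nu> U)"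
      by (rule ennreal_INF_const_minus[symmetric]) auto
    also have "\<dots> \<le> (SUP K\<in>{K. compact K \<and> K \<subseteq> E}. emeasure ?\<nu> K)"
    proof (rule SUP_mono, safe)
      fix U :: "'a set" assume U: "open U" "- E \<subseteq> U"
      have "compact (- U)"
        using U compact_space compact_Int_closed[of UNIV "- U"] by (simp add: closed_Compl)
      then show "\<exists>K\<in>{K. compact K \<and> K \<subseteq> E}. emeasure ?\<nu> UNIV - emeasure ?\<nu> U \<le> emeasure ?\<nu> K"
        using U co[of U] by (intro bexI[of _ "- U"]) auto
    qed
    finally show "emeasure ?\<nu> E \<le> (SUP K\<in>{K. compact K \<and> K \<subseteq> E}. emeasure ?\<nu> K)" .
  qed
qed (auto intro: riesz.finite_measure_axioms)

section \<open>Integrals against the Riesz measure\<close>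

lemma riesz_integrable:
  assumes "continuous_on UNIV (f :: 'a \<Rightarrow> real)"
  shows "integrable (riesz_measure \<Lambda>) f"
proof -
  obtain B where "\<And>x. norm (f x) \<le> B"
    using continuous_on_compact_bounded[OF compact_space assms] by blast
  then show ?thesis
    using assms
    by (intro riesz.integrable_const_bound[of _ B])
       (auto cong: measurable_cong_sets intro: borel_measurable_continuous_onI)
qed

lemma le_riesz_integral:
  assumes f: "continuous_on UNIV f" "\<And>x. 0 \<le> f x" "\<And>x. f x \<le> 1"
  shows "\<Lambda> f \<le> integral\<^sup>L (riesz_measure \<Lambda>) f"
proof (rule field_le_epsilon)
  fix e :: real assume "e > 0"
  let ?\<nu> = "riesz_measure \<Lambda>"
  \<comment> \<open>\<open>n\<close> is the number of slices, and
    \<open>measure ?\<nu> UNIV / n\<close> bounds the error of the sum.\<close>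
  obtain n :: nat where n: "n > 0" "measure ?\<nu> UNIV / n < e"
  proof -
    obtain m :: nat where m: "measure ?\<nu> UNIV / e < m"
      using reals_Archimedean2 by blast
    have "measure ?\<nu> UNIV / (Suc m) < e"
      using m \<open>e > 0\<close> by (simp add: field_simps)
    then show thesis using that[of "Suc m"] by simp
  qed
  \<comment> \<open>\<open>f\<close> is the average of its slices \<open>s k\<close>, which bounds \<open>\<Lambda> f\<close> by a Riemann sum of the layer-cake formula\<close>
  define s where "s k x = min 1 (max 0 (n * f x - real k))" for k x
  have sc: "continuous_on UNIV (s k)" for k
    unfolding s_def by (intro continuous_intros f)
  have part: "(\<Sum>k<m. min 1 (max 0 (t - real k))) = min t m" if "0 \<le> t" for t and m :: nat
    using that by (induction m) auto
  have sum_s: "(\<Sum>k<n. s k x) = n * f x" for x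
    using part[of "n * f x" n] f(2,3)[of x] by (simp add: s_def mult_left_le)
  define V where "V k = {x. real k < n * f x}" for k
  have V: "open (V k)" for k
    unfolding V_def by (intro open_Collect_less continuous_intros f)
  have meas: "\<Lambda> (s k) \<le> measure ?\<nu> (V k)" for k
  proof -
    have "s k \<in> subordinate (V k)"
      using sc by (auto simp: subordinate_def s_def V_def indicator_def)
    then have "ennreal (\<Lambda> (s k)) \<le> emeasure ?\<nu> (V k)"
      unfolding emeasure_riesz_measure[OF borel_open[OF V]] outer_content_open[OF V] open_content_def
      by (rule SUP_upper)
    then show ?thesis
      by (simp add: riesz.emeasure_eq_measure)
  qed
  \<comment> \<open>On \<open>V (Suc k)\<close> the slice with index \<open>k\<close> has reached
    its full height 1, so the shifted indicators lie below the slices.\<close>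
  have ind: "(\<Sum>k<m. indicator (V (Suc k)) x) \<le> n * f x" for m x
  proof -
    have "(\<Sum>k<m. indicator (V (Suc k)) x) \<le> (\<Sum>k<m. min 1 (max 0 (n * f x - real k)))"
      by (intro sum_mono) (auto simp: V_def indicator_def)
    also have "\<dots> \<le> n * f x"
      using part[of "n * f x" m] f(2)[of x] by simp
    finally show ?thesis .
  qed
  have "n * \<Lambda> f = (\<Sum>k<n. \<Lambda> (s k))"
    using sum[of "{..<n}" s] sc scale[OF f(1), of n] by (simp add: sum_s)
  also have "\<dots> \<le> (\<Sum>k<n. measure ?\<nu> (V k))"
    by (intro sum_mono meas)
  \<comment> \<open>Peeling off \<open>V 0\<close>, which costs at most the total mass, leaves the
    shifted sets whose indicators sum to at most \<open>n * f\<close>.\<close>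
  also have "\<dots> = measure ?\<nu> (V 0) + (\<Sum>k<n-1. measure ?\<nu> (V (Suc k)))"
    using n(1) sum.lessThan_Suc_shift[of "\<lambda>k. measure ?\<nu> (V k)" "n - 1"] by simp
  also have "(\<Sum>k<n-1. measure ?\<nu> (V (Suc k))) = (\<integral>x. (\<Sum>k<n-1. indicator (V (Suc k)) x) \<partial>?\<nu>)"
    using V by (subst Bochner_Integration.integral_sum) (auto simp: riesz.emeasure_eq_measure)
  also have "\<dots> \<le> (\<integral>x. n * f x \<partial>?\<nu>)"
    using V by (intro integral_mono ind integrable_mult_right riesz_integrable[OF f(1)]
        Bochner_Integration.integrable_sum) (auto simp: riesz.emeasure_eq_measure)
  also have "measure ?\<nu> (V 0) \<le> measure ?\<nu> UNIV"
    using V by (intro riesz.finite_measure_mono) auto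
  finally have "n * \<Lambda> f \<le> measure ?\<nu> UNIV + n * integral\<^sup>L ?\<nu> f"
    by simp
  also have "\<dots> \<le> n * (integral\<^sup>L ?\<nu> f + e)"
    using n by (simp add: field_simps)
  finally show "\<Lambda> f \<le> integral\<^sup>L ?\<nu> f + e"
    using n(1) by simp
qed

text \<open>The one-sided estimate applied to \<open>g\<close> and to \<open>1 - g\<close> forces
  equality for values in [0,1], because the total mass is exact. An affine change reaches every
  continuous function.\<close>

theorem riesz_representation:
  assumes f: "continuous_on UNIV f"
  shows "\<Lambda> f = integral\<^sup>L (riesz_measure \<Lambda>) f"
proof -
  let ?\<nu> = "riesz_measure \<Lambda>"
  have L1: "measure ?\<nu> UNIV = \<Lambda> (\<lambda>x. 1)"
    using nonneg[of "\<lambda>x. 1"] by (simp add: measure_def emeasure_riesz_measure_UNIV)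
  have unit: "\<Lambda> g = integral\<^sup>L ?\<nu> g"
    if g: "continuous_on UNIV g" "\<And>x. 0 \<le> g x" "\<And>x. g x \<le> 1" for g
  proof (rule antisym)
    show "\<Lambda> g \<le> integral\<^sup>L ?\<nu> g" using g by (rule le_riesz_integral)
    have "\<Lambda> (\<lambda>x. 1 - g x) \<le> (\<integral>x. 1 - g x \<partial>?\<nu>)"
      using g by (intro le_riesz_integral continuous_intros) auto
    then show "integral\<^sup>L ?\<nu> g \<le> \<Lambda> g"
      using diff[of "\<lambda>x. 1" g] g(1) riesz_integrable[OF g(1)] L1 by simp
  qed
  obtain B0 where B0: "\<And>x. norm (f x) \<le> B0"
    using continuous_on_compact_bounded[OF compact_space assms] by blast
  \<comment> \<open>\<open>B0\<close> is nonnegative, as the norm at the arbitrary point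
    \<open>undefined\<close> shows; adding 1 permits division by \<open>2 * B\<close>.\<close>
  define B where "B = B0 + 1"
  have B: "B > 0" "\<And>x. \<bar>f x\<bar> \<le> B"
    using B0 order_trans[OF norm_ge_zero B0[of undefined]]
    by (auto simp: B_def intro: add_increasing2)
  define g where "g x = (f x + B) / (2 * B)" for x
  have gc: "continuous_on UNIV g"
    unfolding g_def using f B(1) by (intro continuous_intros) auto
  have "0 \<le> g x" "g x \<le> 1" for x
    using B(1) B(2)[of x] by (auto simp: g_def field_simps abs_le_iff)
  then have g: "\<Lambda> g = integral\<^sup>L ?\<nu> g"
    by (intro unit gc)
  have fg: "f = (\<lambda>x. 2 * B * g x - B)"
    using B(1) by (auto simp: g_def)
  have "\<Lambda> f = 2 * B * \<Lambda> g - B * \<Lambda> (\<lambda>x. 1)"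
    unfolding fg using gc diff[of "\<lambda>x. 2 * B * g x" "\<lambda>x. B"] scale[of g "2 * B"] const[of B]
    by (simp add: continuous_on_mult_left)
  also have "\<dots> = integral\<^sup>L ?\<nu> f"
    unfolding fg using riesz_integrable[OF gc] by (simp add: g L1)
  finally show ?thesis .
qed

end

text \<open>The order passes through suprema over functions and infima over open sets. It later
  makes each component measure absolutely continuous with respect to that of the sum.\<close>

lemma riesz_measure_mono:
  assumes "positive_functional \<Lambda>" "positive_functional \<Lambda>'"
    and le: "\<And>f. continuous_on UNIV f \<Longrightarrow> (\<And>x. 0 \<le> f x) \<Longrightarrow> \<Lambda> f \<le> \<Lambda>' f"
    and "E \<in> sets borel"
  shows "emeasure (riesz_measure \<Lambda>) E \<le> emeasure (riesz_measure \<Lambda>') E"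
proof -
  have "open_content \<Lambda> U \<le> open_content \<Lambda>' U" for U
    unfolding open_content_def
    by (intro SUP_mono) (auto intro!: bexI ennreal_leI le simp: subordinate_def)
  then have "outer_content \<Lambda> E \<le> outer_content \<Lambda>' E"
    unfolding outer_content_def by (auto intro!: INF_mono)
  then show ?thesis
    using assms by (simp add: positive_functional.emeasure_riesz_measure)
qed

section \<open>Weak-* cluster points of bounded sequences of densities\<close>

text \<open>Tychonoff's theorem gives a cluster point \<open>L\<close> in the product of the
  intervals \<open>{- B i..B i}\<close>. A filter finer than \<open>sequentially\<close> replaces a
  subsequence, which need not exist when the index type is uncountable.\<close>

lemma pointwise_bounded_cluster:
  fixes T :: "nat \<Rightarrow> 'i \<Rightarrow> real"
  assumes "\<And>n i. \<bar>T n i\<bar> \<le> B i"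
  obtains F L where "F \<noteq> bot" "F \<le> sequentially" "\<And>i. ((\<lambda>n. T n i) \<longlongrightarrow> L i) F"
proof -
  let ?S = "PiE UNIV (\<lambda>i. {- B i..B i})"
  have "compactin (product_topology (\<lambda>i::'i. euclidean) UNIV) ?S"
    by (auto simp: compactin_PiE)
  then have "compact ?S"
    by (simp add: euclidean_product_topology)
  moreover have "eventually (\<lambda>t. t \<in> ?S) (filtermap T sequentially)"
    using assms by (auto simp: eventually_filtermap abs_le_iff minus_le_iff PiE_iff
        intro!: always_eventually)
  moreover have "filtermap T sequentially \<noteq> bot"
    by (simp add: filtermap_bot_iff)
  ultimately obtain L where L: "inf (nhds L) (filtermap T sequentially) \<noteq> bot"
    unfolding compact_filter by blast
  \<comment> \<open>The neighbourhoods of \<open>L\<close> pulled back along the sequence; that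
    \<open>L\<close> is a cluster point makes the filter nontrivial.\<close>
  define F where "F = inf (filtercomap T (nhds L)) sequentially"
  show thesis
  proof (rule that[of F L])
    show "F \<noteq> bot"
    proof
      assume "F = bot"
      then have "eventually (\<lambda>x. False) F" by simp
      then obtain P Q where PQ: "eventually P (filtercomap T (nhds L))" "eventually Q sequentially"
          "\<And>x. P x \<Longrightarrow> Q x \<Longrightarrow> False"
        unfolding F_def eventually_inf by blast
      from PQ(1) obtain R where R: "eventually R (nhds L)" "\<And>x. R (T x) \<Longrightarrow> P x"
        unfolding eventually_filtercomap by blast
      have "eventually (\<lambda>t. \<not> R t) (filtermap T sequentially)"
        unfolding eventually_filtermap using PQ(2) by eventually_elim (use PQ(3) R(2) in blast)
      with R(1) have "eventually (\<lambda>t. False) (inf (nhds L) (filtermap T sequentially))"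
        unfolding eventually_inf by blast
      with L show False
        by (simp add: eventually_False)
    qed
    show "F \<le> sequentially"
      by (simp add: F_def)
    fix i
    have "filterlim T (nhds L) F"
      unfolding F_def filterlim_iff_le_filtercomap by simp
    moreover have "continuous_on UNIV (\<lambda>t :: 'i \<Rightarrow> real. t i)"
      by (rule continuous_on_product_coordinates)
    then have "((\<lambda>t. t i) \<longlongrightarrow> L i) (nhds L)"
      unfolding continuous_on_def using tendsto_at_iff_tendsto_nhds[of "\<lambda>t. t i" L] by blast
    ultimately show "((\<lambda>n. T n i) \<longlongrightarrow> L i) F"
      by (rule filterlim_compose[rotated])
  qed
qed

text \<open>Rotation by \<open>\<i> ^ j\<close> exposes in turn the positive real, negative
  imaginary, negative real and positive imaginary part; \<open>(- \<i>) ^ j\<close> rotates each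
  back.\<close>

lemma complex_of_quadrants:
  "z = (\<Sum>j<4::nat. complex_of_real (max 0 (Re (z * \<i> ^ j))) * (- \<i>) ^ j)"
  by (simp add: numeral_eq_Suc complex_eq_iff max_def)

lemma bounded_times_integrable:
  fixes \<phi> q :: "'a \<Rightarrow> 'b::{real_normed_algebra,banach,second_countable_topology}"
  assumes "\<phi> \<in> borel_measurable M" "\<And>x. norm (\<phi> x) \<le> B" "integrable M q"
  shows "integrable M (\<lambda>x. \<phi> x * q x)"
proof (rule Bochner_Integration.integrable_bound)
  show "integrable M (\<lambda>x. B * norm (q x))"
    using assms by auto
  show "(\<lambda>x. \<phi> x * q x) \<in> borel_measurable M"
    using assms by measurable
  show "AE x in M. norm (\<phi> x * q x) \<le> norm (B * norm (q x))"
  proof (rule AE_I2)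
    fix x
    have "norm (\<phi> x * q x) \<le> norm (\<phi> x) * norm (q x)"
      by (rule norm_mult_ineq)
    also have "\<dots> \<le> B * norm (q x)"
      using assms(2) by (rule mult_right_mono) simp
    finally show "norm (\<phi> x * q x) \<le> norm (B * norm (q x))"
      by simp
  qed
qed

lemma integral_complex_times_real:
  fixes \<phi> :: "'a \<Rightarrow> complex" and q :: "'a \<Rightarrow> real"
  assumes "\<phi> \<in> borel_measurable M" "\<And>x. cmod (\<phi> x) \<le> B" "integrable M q"
  shows "(\<integral>x. \<phi> x * of_real (q x) \<partial>M)
       = of_real (\<integral>x. Re (\<phi> x) * q x \<partial>M) + \<i> * of_real (\<integral>x. Im (\<phi> x) * q x \<partial>M)"
proof -
  have "integrable M (\<lambda>x. \<phi> x * of_real (q x))"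
    using assms by (intro bounded_times_integrable[of _ _ B]) auto
  from integral_Re[OF this] integral_Im[OF this] show ?thesis
    by (simp add: complex_eq_iff)
qed

text \<open>A filter is used because the dual ball need not be weak-* sequentially compact. The
  limit is delivered as a density over one positive measure to match the encoding in
  \<open>in_weak_star_closure\<close>.\<close>

theorem L1_bounded_weak_star_cluster:
  fixes \<mu> :: "'a::t2_space measure" and g :: "nat \<Rightarrow> 'a \<Rightarrow> complex"
  assumes cpt: "compact (UNIV :: 'a set)" and sets: "sets \<mu> = sets borel"
    and g: "\<And>n. integrable \<mu> (g n)" and bd: "\<And>n. (\<integral>x. cmod (g n x) \<partial>\<mu>) \<le> C"
  obtains F \<nu> u where "F \<noteq> bot" "F \<le> sequentially" "finite_regular_borel \<nu>" "integrable \<nu> u"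
    "\<And>\<phi>. continuous_on UNIV \<phi> \<Longrightarrow>
        ((\<lambda>n. \<integral>x. \<phi> x * g n x \<partial>\<mu>) \<longlongrightarrow> (\<integral>x. \<phi> x * u x \<partial>\<nu>)) F"
proof -
  define p where "p j n x = max 0 (Re (g n x * \<i> ^ j))" for j n x
  have [measurable]: "g n \<in> borel_measurable \<mu>" for n
    using g by auto
  have p0: "0 \<le> p j n x" and p1: "p j n x \<le> cmod (g n x)" for j n x
    using abs_Re_le_cmod[of "g n x * \<i> ^ j"] by (auto simp: p_def norm_mult norm_power)
  have p: "integrable \<mu> (p j n)" for j n
  proof (rule Bochner_Integration.integrable_bound)
    show "integrable \<mu> (\<lambda>x. cmod (g n x))" using g by auto
    show "p j n \<in> borel_measurable \<mu>" unfolding p_def by measurable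
  qed (use p0 p1 in auto)
  have gp: "g n x = (\<Sum>j<4. complex_of_real (p j n x) * (- \<i>) ^ j)" for n x
    unfolding p_def by (rule complex_of_quadrants)
  have cm: "\<phi> \<in> borel_measurable M" if "continuous_on UNIV \<phi>" "sets M = sets borel"
    for \<phi> :: "'a \<Rightarrow> 'b::topological_space" and M
    using that by (simp add: borel_measurable_continuous_onI cong: measurable_cong_sets)
  have pi: "integrable \<mu> (\<lambda>x. \<phi> x * p j n x)" if c: "continuous_on UNIV \<phi>" for \<phi> j n
  proof -
    obtain B where "\<And>x. norm (\<phi> x) \<le> B"
      using continuous_on_compact_bounded[OF cpt c] by blast
    then show ?thesis
      using cm[OF c sets] p by (intro bounded_times_integrable[of _ _ B])
  qed
  \<comment> \<open>The index runs over all parts and all test functions, so that a single filter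
    serves them simultaneously. The value 0 at discontinuous \<open>\<phi>\<close> keeps every
    coordinate bounded.\<close>
  define T where "T n i = (case i of (j, \<phi>) \<Rightarrow>
      if continuous_on UNIV \<phi> then (\<integral>x. \<phi> x * p j n x \<partial>\<mu>) else 0)" for n and i :: "nat \<times> ('a \<Rightarrow> real)"
  have "\<exists>B. \<forall>n. \<bar>T n i\<bar> \<le> B" for i
  proof (cases i)
    case (Pair j \<phi>)
    show ?thesis
    proof (cases "continuous_on UNIV \<phi>")
      case True
      obtain B where B: "\<And>x. norm (\<phi> x) \<le> B"
        using continuous_on_compact_bounded[OF cpt True] by blast
      have "0 \<le> B"
        using norm_ge_zero B by (rule order_trans)
      have "\<bar>T n i\<bar> \<le> B * C" for n
      proof -
        have "\<bar>T n i\<bar> \<le> (\<integral>x. \<bar>\<phi> x * p j n x\<bar> \<partial>\<mu>)"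
          using True integral_norm_bound[of \<mu> "\<lambda>x. \<phi> x * p j n x"] by (simp add: T_def Pair)
        also have "\<dots> \<le> (\<integral>x. B * cmod (g n x) \<partial>\<mu>)"
        proof (rule integral_mono)
          show "\<bar>\<phi> x * p j n x\<bar> \<le> B * cmod (g n x)" for x
            using B[of x] p0[of j n x] p1[of j n x] \<open>0 \<le> B\<close> by (auto simp: abs_mult intro!: mult_mono)
        qed (use pi[OF True] g in auto)
        also have "\<dots> \<le> B * C"
          using bd[of n] \<open>0 \<le> B\<close> by (simp add: mult_left_mono)
        finally show ?thesis .
      qed
      then show ?thesis by blast
    qed (auto simp: T_def Pair)
  qed
  then obtain B where "\<And>n i. \<bar>T n i\<bar> \<le> B i"
    by metis
  from pointwise_bounded_cluster[of T, OF this]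
  obtain F L where F: "F \<noteq> bot" "F \<le> sequentially" and L: "\<And>i. ((\<lambda>n. T n i) \<longlongrightarrow> L i) F"
    by blast
  define \<Lambda> where "\<Lambda> j \<phi> = L (j, \<phi>)" for j \<phi>
  have lim: "((\<lambda>n. \<integral>x. \<phi> x * p j n x \<partial>\<mu>) \<longlongrightarrow> \<Lambda> j \<phi>) F" if "continuous_on UNIV \<phi>" for j \<phi>
    using L[of "(j, \<phi>)"] that by (simp add: T_def \<Lambda>_def)
  have pos: "positive_functional (\<Lambda> j)" for j
  proof
    show "compact (UNIV :: 'a set)" by fact
    fix \<phi> \<psi> :: "'a \<Rightarrow> real" and c :: real
    assume \<phi>: "continuous_on UNIV \<phi>"
    have "((\<lambda>n. \<integral>x. (c * \<phi> x) * p j n x \<partial>\<mu>) \<longlongrightarrow> c * \<Lambda> j \<phi>) F"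
      using tendsto_mult_left[OF lim[OF \<phi>], of c j] by (simp add: mult.assoc)
    then show "\<Lambda> j (\<lambda>x. c * \<phi> x) = c * \<Lambda> j \<phi>"
      using tendsto_unique[OF F(1) lim] \<phi> by (metis continuous_on_mult_left)
    show "0 \<le> \<Lambda> j \<phi>" if "\<And>x. 0 \<le> \<phi> x"
      using that p0 by (intro tendsto_lowerbound[OF lim[OF \<phi>] _ F(1)]) auto
    assume \<psi>: "continuous_on UNIV \<psi>"
    have "((\<lambda>n. \<integral>x. (\<phi> x + \<psi> x) * p j n x \<partial>\<mu>) \<longlongrightarrow> \<Lambda> j \<phi> + \<Lambda> j \<psi>) F"
      using tendsto_add[OF lim[OF \<phi>] lim[OF \<psi>], of j j] pi[OF \<phi>] pi[OF \<psi>]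
      by (simp add: distrib_right)
    then show "\<Lambda> j (\<lambda>x. \<phi> x + \<psi> x) = \<Lambda> j \<phi> + \<Lambda> j \<psi>"
      using tendsto_unique[OF F(1) lim] \<phi> \<psi> by (metis continuous_on_add)
  qed
  \<comment> \<open>The sum dominates each \<open>\<Lambda> j\<close> on nonnegative functions, so
    its measure can be a common base for all four densities.\<close>
  define \<Theta> where "\<Theta> \<phi> = (\<Sum>j<4::nat. \<Lambda> j \<phi>)" for \<phi>
  interpret P: positive_functional "\<Lambda> j" for j
    by (rule pos)
  interpret Q: positive_functional \<Theta>
    by standard
      (auto simp: \<Theta>_def P.add P.scale sum.distrib sum_distrib_left cpt intro!: sum_nonneg P.nonneg)
  let ?\<nu> = "riesz_measure \<Theta>"
  have ac: "absolutely_continuous ?\<nu> (riesz_measure (\<Lambda> j))" if "j < 4" for j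
    unfolding absolutely_continuous_def
  proof
    fix E assume "E \<in> null_sets ?\<nu>"
    then have E: "E \<in> sets borel" "emeasure ?\<nu> E = 0"
      by auto
    have "\<Lambda> j \<phi> \<le> \<Theta> \<phi>" if "continuous_on UNIV \<phi>" "\<And>x. 0 \<le> \<phi> x" for \<phi>
      unfolding \<Theta>_def using \<open>j < 4\<close> that by (intro member_le_sum P.nonneg) auto
    then have "emeasure (riesz_measure (\<Lambda> j)) E \<le> emeasure ?\<nu> E"
      by (rule riesz_measure_mono[OF pos Q.positive_functional_axioms _ E(1)])
    then show "E \<in> null_sets (riesz_measure (\<Lambda> j))"
      using E by auto
  qed
  \<comment> \<open>For \<open>j < 4\<close> the derivative is finite almost everywhere, so
    \<open>enn2real\<close> alters it only on a null set.\<close>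
  define d where "d j x = enn2real (RN_deriv ?\<nu> (riesz_measure (\<Lambda> j)) x)" for j x
  have d: "integrable ?\<nu> (d j)" and rep: "\<And>\<phi>. continuous_on UNIV \<phi> \<Longrightarrow> (\<integral>x. \<phi> x * d j x \<partial>?\<nu>) = \<Lambda> j \<phi>"
    if "j < 4" for j
  proof -
    have sf: "sigma_finite_measure (riesz_measure (\<Lambda> j))"
      by (rule P.riesz.sigma_finite_measure_axioms)
    show "integrable ?\<nu> (d j)"
      using Q.riesz.RN_deriv_integrable[OF sf ac[OF that], of "\<lambda>x. 1"] by (simp add: d_def[abs_def])
    show "(\<integral>x. \<phi> x * d j x \<partial>?\<nu>) = \<Lambda> j \<phi>" if \<phi>: "continuous_on UNIV \<phi>" for \<phi>
      using Q.riesz.RN_deriv_integral[OF sf ac[OF \<open>j < 4\<close>] _ cm[OF \<phi>]] P.riesz_representation[OF \<phi>]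
      by (simp add: d_def mult.commute)
  qed
  define u where "u x = (\<Sum>j<4. complex_of_real (d j x) * (- \<i>) ^ j)" for x
  \<comment> \<open>Kept general because it serves twice: for \<open>\<mu>\<close> with the parts
    \<open>p\<close> and for the limit measure with the densities \<open>d\<close>.\<close>
  have decomp: "(\<integral>x. \<phi> x * (\<Sum>j<4. complex_of_real (q j x) * (- \<i>) ^ j) \<partial>M)
      = (\<Sum>j<4. (of_real (\<integral>x. Re (\<phi> x) * q j x \<partial>M) + \<i> * of_real (\<integral>x. Im (\<phi> x) * q j x \<partial>M)) * (- \<i>) ^ j)"
    if \<phi>: "continuous_on UNIV \<phi>" and M: "sets M = sets borel" and q: "\<And>j. j < 4 \<Longrightarrow> integrable M (q j)"
    for \<phi> q and M :: "'a measure"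
  proof -
    obtain B where B: "\<And>x. norm (\<phi> x) \<le> B"
      using continuous_on_compact_bounded[OF cpt \<phi>] by blast
    have i: "integrable M (\<lambda>x. \<phi> x * complex_of_real (q j x))" if "j < 4" for j
      using cm[OF \<phi> M] B q[OF that] by (intro bounded_times_integrable[of _ _ B]) auto
    have "integrable M (\<lambda>x. \<phi> x * (complex_of_real (q j x) * (- \<i>) ^ j))" if "j < 4" for j
      using integrable_mult_left[OF i[OF that], of "(- \<i>) ^ j"] by (simp add: mult.assoc)
    then have "(\<integral>x. \<phi> x * (\<Sum>j<4. complex_of_real (q j x) * (- \<i>) ^ j) \<partial>M)
        = (\<Sum>j<4. (\<integral>x. \<phi> x * complex_of_real (q j x) * (- \<i>) ^ j \<partial>M))"
      unfolding sum_distrib_left mult.assoc by (intro Bochner_Integration.integral_sum) auto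
    then show ?thesis
      using cm[OF \<phi> M] B q by (simp add: integral_complex_times_real[of _ _ B])
  qed
  show thesis
  proof (rule that[OF F Q.finite_regular_borel_riesz_measure])
    show "integrable ?\<nu> u"
      unfolding u_def using d by (intro Bochner_Integration.integrable_sum integrable_mult_left) auto
    fix \<phi> :: "'a \<Rightarrow> complex" assume \<phi>: "continuous_on UNIV \<phi>"
    then have RI: "continuous_on UNIV (\<lambda>x. Re (\<phi> x))" "continuous_on UNIV (\<lambda>x. Im (\<phi> x))"
      by (auto intro: continuous_intros)
    have "(\<integral>x. \<phi> x * u x \<partial>?\<nu>) = (\<Sum>j<4. (of_real (\<Lambda> j (\<lambda>x. Re (\<phi> x)))
        + \<i> * of_real (\<Lambda> j (\<lambda>x. Im (\<phi> x)))) * (- \<i>) ^ j)"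
      unfolding u_def by (subst decomp[OF \<phi>]) (auto simp: d rep RI)
    moreover have "((\<lambda>n. \<integral>x. \<phi> x * g n x \<partial>\<mu>) \<longlongrightarrow> (\<Sum>j<4. (of_real (\<Lambda> j (\<lambda>x. Re (\<phi> x)))
        + \<i> * of_real (\<Lambda> j (\<lambda>x. Im (\<phi> x)))) * (- \<i>) ^ j)) F"
      unfolding gp decomp[OF \<phi> sets p] by (intro tendsto_intros lim RI)
    ultimately show "((\<lambda>n. \<integral>x. \<phi> x * g n x \<partial>\<mu>) \<longlongrightarrow> (\<integral>x. \<phi> x * u x \<partial>?\<nu>)) F"
      by simp
  qed
qed

section \<open>Peak points and the projection\<close>

theorem theorem3p7:
  fixes \<mu> :: "'a::t2_space measure"
    and H :: "('a \<Rightarrow> complex) set"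
    and A :: "('a \<Rightarrow> complex) set"
    and x0 :: 'a
    and f0 :: "'a \<Rightarrow> complex"
  assumes X_compact: "compact (UNIV :: 'a set)"
    and X_connected: "connected (UNIV :: 'a set)"
    and mu_reg: "finite_regular_borel \<mu>"
    and mu_supp: "full_support \<mu>"
    and H_sub: "closed_L2_subspace \<mu> H"
    and A_sub: "A \<subseteq> H"
    and A_cont: "\<forall>a\<in>A. continuous_on UNIV a"
    and A_const: "\<forall>c. (\<lambda>x. c) \<in> A"
    and A_add: "\<forall>a\<in>A. \<forall>b\<in>A. (\<lambda>x. a x + b x) \<in> A"
    and A_smult: "\<forall>c. \<forall>a\<in>A. (\<lambda>x. c * a x) \<in> A"
    and A_mult: "\<forall>a\<in>A. \<forall>b\<in>A. (\<lambda>x. a x * b x) \<in> A"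
    and peak: "f0 \<in> A" "f0 x0 = 1" "\<forall>x. x \<noteq> x0 \<longrightarrow> cmod (f0 x) < 1"
    and no_atom: "\<forall>\<nu> u. finite_regular_borel \<nu> \<and> integrable \<nu> u \<and>
                    in_weak_star_closure \<mu> H \<nu> u \<longrightarrow>
                    set_lebesgue_integral \<nu> {x0} u = 0"
  shows "\<not> proj_extends_boundedly_L1 \<mu> H"
proof
  assume "proj_extends_boundedly_L1 \<mu> H"
  then obtain C where C: "\<And>f g. square_integrable \<mu> f \<Longrightarrow> orth_proj_L2 \<mu> H f g \<Longrightarrow>
        (\<integral>x. cmod (g x) \<partial>\<mu>) \<le> C * (\<integral>x. cmod (f x) \<partial>\<mu>)"
    unfolding proj_extends_boundedly_L1_def by blast
  have sets [measurable_cong]: "sets \<mu> = sets borel" and "finite_measure \<mu>"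
    using mu_reg by (auto simp: finite_regular_borel_def)
  interpret finite_measure \<mu> by fact
  have HI: "square_integrable \<mu> h" "integrable \<mu> h" if "h \<in> H" for h
    using H_sub that L2_imp_L1[OF \<open>finite_measure \<mu>\<close>]
    unfolding closed_L2_subspace_def by blast+
  have f0_cont: "continuous_on UNIV f0"
    using A_cont peak(1) by blast
  have f0_le: "cmod (f0 x) \<le> 1" for x
    using peak(2,3) by (cases "x = x0") (auto intro: less_imp_le)
  have f0_pow: "(\<lambda>x. f0 x ^ k) \<in> A" for k
    by (induction k) (use A_const A_mult peak(1) in auto)

  \<comment> \<open>Normalised indicators near the peak point\<close>
  define U where "U n = {x. cmod (f0 x - 1) < 1 / Suc n}" for n
  have U_open: "open (U n)" for n
    unfolding U_def by (intro open_Collect_less continuous_intros f0_cont)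
  have U [measurable]: "U n \<in> sets \<mu>" for n
    using U_open sets by auto
  have "x0 \<in> U n" for n
    using peak(2) by (simp add: U_def)
  \<comment> \<open>Full support enters here and makes the normalisation possible.\<close>
  then have "emeasure \<mu> (U n) > 0" for n
    using mu_supp U_open unfolding full_support_def by blast
  then have mU: "measure \<mu> (U n) > 0" for n
    by (simp add: emeasure_eq_measure)
  define f where "f n x = complex_of_real (indicator (U n) x / measure \<mu> (U n))" for n x
  have f_int: "integrable \<mu> (f n)" for n
    unfolding f_def by (auto simp: emeasure_eq_measure)
  have f_sq: "square_integrable \<mu> (f n)" for n
  proof -
    have "(cmod (f n x))\<^sup>2 = indicator (U n) x / (measure \<mu> (U n))\<^sup>2" for x
      by (simp add: f_def norm_divide power_divide indicator_def)
    then show ?thesis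
      using f_int[of n] by (auto simp: square_integrable_def emeasure_eq_measure)
  qed
  have f_norm: "(\<integral>x. cmod (f n x) \<partial>\<mu>) = 1" for n
  proof -
    have "cmod (f n x) = indicator (U n) x / measure \<mu> (U n)" for x
      by (simp add: f_def norm_divide indicator_def)
    then show ?thesis
      using mU[of n] by simp
  qed
  have f_total: "(\<integral>x. f n x \<partial>\<mu>) = 1" for n
    using mU[of n] unfolding f_def integral_complex_of_real by simp

  \<comment> \<open>Projections and their cluster measure\<close>
  have "\<forall>n. \<exists>g. orth_proj_L2 \<mu> H (f n) g"
    using orth_proj_L2_exists[OF H_sub f_sq] by blast
  then obtain g where g: "\<And>n. orth_proj_L2 \<mu> H (f n) (g n)"
    by metis
  have gH: "g n \<in> H" for n
    using g by (simp add: orth_proj_L2_def)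
  have "(\<integral>x. cmod (g n x) \<partial>\<mu>) \<le> C" for n
    using C[OF f_sq g, of n] by (simp add: f_norm)
  then obtain F \<nu> u where F: "F \<noteq> bot" "F \<le> sequentially"
    and \<nu>: "finite_regular_borel \<nu>" and u: "integrable \<nu> u"
    and lim: "\<And>\<phi>. continuous_on UNIV \<phi> \<Longrightarrow>
        ((\<lambda>n. \<integral>x. \<phi> x * g n x \<partial>\<mu>) \<longlongrightarrow> (\<integral>x. \<phi> x * u x \<partial>\<nu>)) F"
    by (rule L1_bounded_weak_star_cluster[OF X_compact sets HI(2)[OF gH]]) (rule that; assumption)

  have "in_weak_star_closure \<mu> H \<nu> u"
    unfolding in_weak_star_closure_def
  proof safe
    fix G :: "('a \<Rightarrow> complex) set" and \<epsilon> :: real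
    assume G: "finite G" "\<forall>\<phi>\<in>G. continuous_on UNIV \<phi>" and "\<epsilon> > 0"
    \<comment> \<open>A basic weak-* neighbourhood tests finitely many functions, so closeness to
      all of them holds eventually along \<open>F\<close>; as \<open>F\<close> is nontrivial, some
      \<open>g n\<close> is a witness.\<close>
    have "\<forall>\<^sub>F n in F. \<forall>\<phi>\<in>G. cmod ((\<integral>x. \<phi> x * u x \<partial>\<nu>) - (\<integral>x. \<phi> x * g n x \<partial>\<mu>)) < \<epsilon>"
      using G tendstoD[OF lim \<open>\<epsilon> > 0\<close>]
      by (auto simp: eventually_ball_finite_distrib dist_norm norm_minus_commute)
    then obtain n where "\<forall>\<phi>\<in>G. cmod ((\<integral>x. \<phi> x * u x \<partial>\<nu>) - (\<integral>x. \<phi> x * g n x \<partial>\<mu>)) < \<epsilon>"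
      using F(1) eventually_happens by blast
    then show "\<exists>h\<in>H. \<forall>\<phi>\<in>G. cmod ((\<integral>x. \<phi> x * u x \<partial>\<nu>) - (\<integral>x. \<phi> x * h x \<partial>\<mu>)) < \<epsilon>"
      using gH by blast
  qed
  with no_atom \<nu> u have atom: "set_lebesgue_integral \<nu> {x0} u = 0"
    by blast

  \<comment> \<open>Moments of the cluster measure\<close>
  have moment: "(\<integral>x. cnj (f0 x ^ k) * u x \<partial>\<nu>) = 1" for k
  proof -
    have kH: "(\<lambda>x. f0 x ^ k) \<in> H"
      using A_sub f0_pow by blast
    \<comment> \<open>As \<open>f0 ^ k\<close> lies in \<open>H\<close>, the projection can be
      replaced by \<open>f n\<close>, whose mass sits where \<open>f0\<close> is close to 1.\<close>
    have eq: "(\<integral>x. cnj (f0 x ^ k) * g n x \<partial>\<mu>) = (\<integral>x. cnj (f0 x ^ k) * f n x \<partial>\<mu>)" for n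
      by (rule orth_proj_L2_inner[OF H_sub f_sq g kH])
    have near: "cmod ((\<integral>x. cnj (f0 x ^ k) * f n x \<partial>\<mu>) - 1) \<le> real k * (1 / Suc n)" for n
    proof -
      have i: "integrable \<mu> (\<lambda>x. cnj (f0 x ^ k) * f n x)"
        using square_integrable_mult[OF f_sq HI(1)[OF kH], of n] by (subst mult.commute)
      have "(\<integral>x. cnj (f0 x ^ k) * f n x \<partial>\<mu>) - 1 = (\<integral>x. cnj (f0 x ^ k - 1) * f n x \<partial>\<mu>)"
        using i f_int[of n] f_total[of n] by (simp add: left_diff_distrib)
      also have "cmod \<dots> \<le> (\<integral>x. cmod (cnj (f0 x ^ k - 1) * f n x) \<partial>\<mu>)"
        by (rule integral_norm_bound)
      also have "\<dots> \<le> (\<integral>x. real k * (1 / Suc n) * cmod (f n x) \<partial>\<mu>)"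
      proof (rule integral_mono)
        have "integrable \<mu> (\<lambda>x. cnj (f0 x ^ k - 1) * f n x)"
          using i f_int[of n] by (simp add: left_diff_distrib)
        then show "integrable \<mu> (\<lambda>x. cmod (cnj (f0 x ^ k - 1) * f n x))"
          by (rule integrable_norm)
        show "integrable \<mu> (\<lambda>x. real k * (1 / Suc n) * cmod (f n x))"
          using f_int[of n] by (intro integrable_mult_right integrable_norm)
        fix x
        show "cmod (cnj (f0 x ^ k - 1) * f n x) \<le> real k * (1 / Suc n) * cmod (f n x)"
        proof (cases "x \<in> U n")
          case True
          \<comment> \<open>For \<open>|a| \<le> 1\<close>, telescoping gives
            \<open>|a^k - 1| \<le> k |a - 1|\<close>; defining \<open>U n\<close> through
            \<open>f0\<close> makes the right side small.\<close>
          have "cmod (f0 x ^ k - 1) \<le> real k * cmod (f0 x - 1)"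
            using norm_power_diff[OF f0_le, of 1 x k] by simp
          also have "\<dots> \<le> real k * (1 / Suc n)"
            using True by (intro mult_left_mono) (auto simp: U_def)
          finally show ?thesis
            unfolding norm_mult complex_mod_cnj by (rule mult_right_mono) simp
        qed (simp add: f_def)
      qed
      also have "\<dots> = real k * (1 / Suc n)"
        by (simp add: f_norm)
      finally show ?thesis .
    qed
    have "(\<lambda>n. real k * (1 / Suc n)) \<longlonglongrightarrow> 0"
      by (intro tendsto_mult_right_zero) (use LIMSEQ_inverse_real_of_nat in \<open>simp add: inverse_eq_divide\<close>)
    then have "(\<lambda>n. (\<integral>x. cnj (f0 x ^ k) * f n x \<partial>\<mu>) - 1) \<longlonglongrightarrow> 0"
      by (rule Lim_null_comparison[OF always_eventually[OF allI[OF near]]])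
    then have "(\<lambda>n. \<integral>x. cnj (f0 x ^ k) * f n x \<partial>\<mu>) \<longlonglongrightarrow> 1"
      by (simp add: LIM_zero_iff)
    \<comment> \<open>\<open>F\<close> is finer than \<open>sequentially\<close>, so the ordinary
      limit is also the limit along \<open>F\<close> and must agree with the weak-* limit.\<close>
    then have "((\<lambda>n. \<integral>x. cnj (f0 x ^ k) * g n x \<partial>\<mu>) \<longlongrightarrow> 1) F"
      unfolding eq using F(2) by (rule tendsto_mono[rotated])
    moreover have "((\<lambda>n. \<integral>x. cnj (f0 x ^ k) * g n x \<partial>\<mu>) \<longlongrightarrow> (\<integral>x. cnj (f0 x ^ k) * u x \<partial>\<nu>)) F"
      by (intro lim continuous_intros f0_cont)
    ultimately show ?thesis
      using tendsto_unique[OF F(1)] by blast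
  qed

  \<comment> \<open>The atom at the peak point\<close>
  have "sets \<nu> = sets borel"
    using \<nu> by (simp add: finite_regular_borel_def)
  then have f0_meas [measurable]: "f0 \<in> borel_measurable \<nu>" and x0 [measurable]: "{x0} \<in> sets \<nu>"
    using borel_measurable_continuous_onI[OF f0_cont] by (simp_all cong: measurable_cong_sets)
  have cnj_meas: "(\<lambda>x. cnj (f0 x ^ k)) \<in> borel_measurable \<nu>" for k
    by (intro borel_measurable_continuous_on[of cnj] continuous_intros) measurable
  \<comment> \<open>The powers of \<open>cnj (f0 x)\<close> equal 1 at \<open>x0\<close> and decay
    elsewhere, where \<open>cmod (f0 x) < 1\<close>; \<open>cmod (u x)\<close> dominates the
    products.\<close>
  have "(\<lambda>k. \<integral>x. cnj (f0 x ^ k) * u x \<partial>\<nu>) \<longlonglongrightarrow> (\<integral>x. indicator {x0} x *\<^sub>R u x \<partial>\<nu>)"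
  proof (rule integral_dominated_convergence)
    show "integrable \<nu> (\<lambda>x. cmod (u x))"
      using u by (rule integrable_norm)
    show "(\<lambda>x. indicator {x0} x *\<^sub>R u x) \<in> borel_measurable \<nu>"
      using u by measurable
    show "(\<lambda>x. cnj (f0 x ^ k) * u x) \<in> borel_measurable \<nu>" for k
      using u cnj_meas by (intro borel_measurable_times) auto
    show "AE x in \<nu>. (\<lambda>k. cnj (f0 x ^ k) * u x) \<longlonglongrightarrow> indicator {x0} x *\<^sub>R u x"
    proof (rule AE_I2)
      fix x
      show "(\<lambda>k. cnj (f0 x ^ k) * u x) \<longlonglongrightarrow> indicator {x0} x *\<^sub>R u x"
      proof (cases "x = x0")
        case False
        then have "(\<lambda>k. f0 x ^ k) \<longlonglongrightarrow> 0"
          using peak(3) by (simp add: LIMSEQ_power_zero)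
        then have "(\<lambda>k. cnj (f0 x ^ k) * u x) \<longlonglongrightarrow> cnj 0 * u x"
          by (intro tendsto_mult tendsto_cnj tendsto_const)
        with False show ?thesis by simp
      qed (simp add: peak(2))
    qed
    show "AE x in \<nu>. norm (cnj (f0 x ^ k) * u x) \<le> cmod (u x)" for k
      using f0_le by (intro AE_I2) (simp add: norm_mult norm_power power_le_one mult_left_le_one_le)
  qed
  \<comment> \<open>Every moment is 1, while their limit is the atom at \<open>x0\<close>, which
    vanishes by \<open>atom\<close>.\<close>
  then have "(\<lambda>k::nat. 1::complex) \<longlonglongrightarrow> 0"
    using atom by (simp only: moment set_lebesgue_integral_def)
  then show False
    by (simp add: LIMSEQ_const_iff)
qed

end
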